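(* Let $\rho=(\psi_1,\psi_2)$ be an element of $\mathbf{T}\otimes\mathbf{R}^2$, where $\mathbf{T}$ is the real $16$-dimensional twistor space of $\mathbf{R}^8$. Then: (i) if $\psi_1$ and $\psi_2$ are nonzero, then $\det\rho=0$ if and only if $p(\psi_1)=p(\psi_2)\in S^8$; (ii) $Spin(9,1)\times GL(2,\mathbf{R})$ acts transitively on the open set $\{\det\rho\neq 0\}$ in $\mathbf{T}\otimes\mathbf{R}^2$; (iii) the stabilizer of $\rho$ in $Spin(9,1)\times GL(2,\mathbf{R})$, where $\det\rho\ne 0$, is $G_2\times SL(2,\mathbf{R})$, where $G_2$ is the compact $14$-dimensional automorphism group of the octonions.
   Context: Let $S^+,S^-$ be the two real $8$-dimensional half-spin representations of $Spin(8)$, with invariant positive definite inner products $\langle\,,\rangle$, and Clifford multiplication $\mathbf{R}^8\otimes S^\pm\to S^\mp$, $(x,\varphi)\mapsto x\cdot\varphi$, satisfying $x\cdot(y\cdot\varphi)+y\cdot(x\cdot\varphi)=-2\langle x,y\rangle\varphi$ and $\langle x\cdot\varphi^-,\varphi^+\rangle=-\langle\varphi^-,x\cdot\varphi^+\rangle$. Twistors: $\mathbf{T}$ is the real $16$-dimensional space of $S^+$-valued functions on $\mathbf{R}^8$ of the form $\psi(\mathbf{x})=\mathbf{x}\cdot\varphi^-+\varphi^+$, $\varphi^\pm\in S^\pm$ constant; so $\mathbf{T}\cong S^-\oplus S^+$ via $\psi\leftrightarrow(\varphi^-,\varphi^+)$. Group action: $Spin(9,1)$ acts on $\mathbf{T}$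 as a half-spin representation, lifting the action of orientation-preserving conformal transformations of $S^8=\mathbf{R}^8\cup\{\infty\}$. Concretely it is the subgroup of $GL(\mathbf{T})$ generated by the maps $(\varphi^-,\varphi^+)\mapsto(\varphi^-,\varphi^++u\cdot\varphi^-)$ (translations) and $(\varphi^-,\varphi^+)\mapsto(\varphi^-+u\cdot\varphi^+,\varphi^+)$ (inversion-translation-inversion), $u\in\mathbf{R}^8$; it contains $Spin(8)$ acting on $S^-\oplus S^+$ and the dilations $(\varphi^-,\varphi^+)\mapsto(\lambda^{1/2}\varphi^-,\lambda^{-1/2}\varphi^+)$, $\lambda>0$. An element $\rho\in\mathbf{T}\otimes\mathbf{R}^2$ is written as a pair $(\psi_1,\psi_2)$ of elements $\psi_a=\mathbf{x}\cdot\varphi_a^-+\varphi_a^+$ of $\mathbf{T}$, $a=1,2$; $GL(2,\mathbf{R})$ acts on the $\mathbf{R}^2$ factor in the standard way (replacing $\psi_1,\psi_2$ by linear combinations). Projection $p:\mathbf{T}\setminus\{0\}\to S^8=\mathbf{R}^8\cup\{\infty\}$: if $\varphi^-\ne0$ there is a unique $\mathbf{c}\in\mathbf{R}^8$ with $\psi(\mathbf{x})=(\mathbf{x}-\mathbf{c})\cdot\varphi^-$ and $p(\psi)=\mathbf{c}$; if $\varphi^-=0$ then $p(\psi)=\infty$. Determinant: the functions $f_{ab}(\mathbf{x})=\langle\psi_a(\mathbf{x}),\psi_b(\mathbf{x})\rangle$, $a,b\in\{1,2\}$, lie in the space of functions $f=k\Vert\mathbf{x}\Vert^2+\langle\mathbf{x},\mathbf{b}\rangle+c$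 ($k,c\in\mathbf{R}$, $\mathbf{b}\in\mathbf{R}^8$), on which $L$ is the symmetric bilinear form with $L(f,f)=\langle\mathbf{b},\mathbf{b}\rangle-4kc$. Put $\mu(\rho)=L(f_{11},f_{22})-L(f_{12},f_{21})$ and $\det\rho=-\mu(\rho)/3$. Equivalently, $$\det\rho=\Vert\varphi_1^-\Vert^2\Vert\varphi_2^+\Vert^2+\Vert\varphi_2^-\Vert^2\Vert\varphi_1^+\Vert^2-2\langle\varphi_1^-\cdot\varphi_1^+,\varphi_2^-\cdot\varphi_2^+\rangle,$$ where for $\varphi^\pm\in S^\pm$ the vector $\varphi^+\cdot\varphi^-=\varphi^-\cdot\varphi^+\in\mathbf{R}^8$ is defined by $\langle x,\varphi^+\cdot\varphi^-\rangle=\langle x\cdot\varphi^-,\varphi^+\rangle$ for all $x\in\mathbf{R}^8$.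
   Formalization: In (iii), the stabilizer in Spin(9,1)×GL(2,R) is shown to be G_2×{A: det A=±1}, as it contains elements with det A=-1; it is G_2×SL(2,R) when GL(2,R) is replaced by the matrices of positive determinant. *)

theory Defs
  imports "HOL-Analysis.Analysis" "HOL-Algebra.Generated_Groups" "HOL-Algebra.Group_Action"
begin

subsection \<open>Half-spin representations and twistors\<close>

text \<open>The two half-spin modules are arbitrary 8-dimensional Euclidean spaces \<open>'m\<close> (for \<open>S\<^sup>-\<close>) and
  \<open>'p\<close> (for \<open>S\<^sup>+\<close>); \<open>cm x m\<close> and \<open>cp x p\<close> are the Clifford products \<open>S\<^sup>- \<rightarrow> S\<^sup>+\<close> and \<open>S\<^sup>+ \<rightarrow> S\<^sup>-\<close>.
  Since the Clifford algebra of \<open>R\<^sup>8\<close> is the algebra of real 16 by 16 matrices, these data are unique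
  up to isomorphism and the choice of an orientation of \<open>R\<^sup>8\<close>.\<close>

locale half_spin =
  fixes cm :: "real^8 \<Rightarrow> 'm::euclidean_space \<Rightarrow> 'p::euclidean_space"
    and cp :: "real^8 \<Rightarrow> 'p \<Rightarrow> 'm"
  assumes dim_minus: "DIM('m) = 8"
    and dim_plus: "DIM('p) = 8"
    and bilinear_minus: "bilinear cm"
    and bilinear_plus: "bilinear cp"
    and clifford_minus: "cp x (cm y m) + cp y (cm x m) = (- 2 * (x \<bullet> y)) *\<^sub>R m"
    and clifford_plus: "cm x (cp y p) + cm y (cp x p) = (- 2 * (x \<bullet> y)) *\<^sub>R p"
    and skew: "cm x m \<bullet> p = - (m \<bullet> cp x p)"

text \<open>A twistor is stored as its pair of coefficients \<open>(\<phi>\<^sup>-, \<phi>\<^sup>+)\<close>.\<close>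

fun twistor_fun :: "(real^8 \<Rightarrow> 'm::euclidean_space \<Rightarrow> 'p::euclidean_space) \<Rightarrow> 'm \<times> 'p \<Rightarrow> real^8 \<Rightarrow> 'p"
  where "twistor_fun cm (m, p) x = cm x m + p"

text \<open>The sphere \<open>S\<^sup>8 = R\<^sup>8 \<union> {\<infinity>}\<close> is the option type, with \<^const>\<open>None\<close> as the point at infinity.
  The value of \<open>proj\<close> at the zero twistor carries no meaning.\<close>

definition proj :: "(real^8 \<Rightarrow> 'm::euclidean_space \<Rightarrow> 'p::euclidean_space) \<Rightarrow> 'm \<times> 'p \<Rightarrow> (real^8) option"
  where "proj cm \<psi> =
    (if fst \<psi> = 0 then None
     else Some (THE c. \<forall>x. twistor_fun cm \<psi> x = cm (x - c) (fst \<psi>)))"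


subsection \<open>The determinant\<close>

definition quad_fun :: "real \<Rightarrow> real^8 \<Rightarrow> real \<Rightarrow> real^8 \<Rightarrow> real"
  where "quad_fun k b c x = k * (norm x)\<^sup>2 + x \<bullet> b + c"

text \<open>The polarisation of \<open>b \<bullet> b - 4 * k * c\<close>; only meaningful on functions of the form \<^const>\<open>quad_fun\<close>.\<close>

definition lorentz :: "(real^8 \<Rightarrow> real) \<Rightarrow> (real^8 \<Rightarrow> real) \<Rightarrow> real"
  where "lorentz f g =
    (THE r. \<exists>k b c k' b' c'. f = quad_fun k b c \<and> g = quad_fun k' b' c' \<and>
              r = b \<bullet> b' - 2 * (k * c' + k' * c))"

definition pairing ::
    "(real^8 \<Rightarrow> 'm::euclidean_space \<Rightarrow> 'p::euclidean_space) \<Rightarrow> 'm \<times> 'p \<Rightarrow> 'm \<times> 'p \<Rightarrow> real^8 \<Rightarrow> real"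
  where "pairing cm \<psi> \<psi>' x = twistor_fun cm \<psi> x \<bullet> twistor_fun cm \<psi>' x"

fun twistor_mu ::
    "(real^8 \<Rightarrow> 'm::euclidean_space \<Rightarrow> 'p::euclidean_space) \<Rightarrow> ('m \<times> 'p) \<times> ('m \<times> 'p) \<Rightarrow> real"
  where "twistor_mu cm (\<psi>1, \<psi>2) =
    lorentz (pairing cm \<psi>1 \<psi>1) (pairing cm \<psi>2 \<psi>2) - lorentz (pairing cm \<psi>1 \<psi>2) (pairing cm \<psi>2 \<psi>1)"

definition twistor_det ::
    "(real^8 \<Rightarrow> 'm::euclidean_space \<Rightarrow> 'p::euclidean_space) \<Rightarrow> ('m \<times> 'p) \<times> ('m \<times> 'p) \<Rightarrow> real"
  where "twistor_det cm \<rho> = - twistor_mu cm \<rho> / 3"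

lemma quad_fun_inject:
  assumes "quad_fun k b c = quad_fun k' b' c'"
  shows "k = k' \<and> b = b' \<and> c = c'"
proof -
  have eq: "quad_fun k b c x = quad_fun k' b' c' x" for x
    using assms by simp
  have c: "c = c'"
    using eq[of 0] by (simp add: quad_fun_def)
  have 1: "(k - k') * (norm x)\<^sup>2 + x \<bullet> (b - b') = 0" for x
    using eq[of x] c by (simp add: quad_fun_def algebra_simps)
  have 2: "x \<bullet> (b - b') = 0" for x
    using 1[of x] 1[of "- x"] by simp
  have b: "b = b'"
    using 2[of "b - b'"] by simp
  have "k = k'"
    using 1[of "axis 1 1"] b by (simp add: norm_axis_1)
  with b c show ?thesis by simp
qed

lemma lorentz_quad_fun:
  "lorentz (quad_fun k b c) (quad_fun k' b' c') = b \<bullet> b' - 2 * (k * c' + k' * c)"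
  unfolding lorentz_def by (rule the_equality) (blast dest: quad_fun_inject)+


subsection \<open>Groups\<close>

definition GL_group :: "('a::real_normed_vector \<Rightarrow>\<^sub>L 'a) monoid"
  where "GL_group =
    \<lparr>carrier = {f. \<exists>g. f o\<^sub>L g = id_blinfun \<and> g o\<^sub>L f = id_blinfun},
     mult = (o\<^sub>L), one = id_blinfun\<rparr>"

definition translation ::
    "(real^8 \<Rightarrow> 'm::euclidean_space \<Rightarrow> 'p::euclidean_space) \<Rightarrow> real^8 \<Rightarrow> ('m \<times> 'p) \<Rightarrow>\<^sub>L ('m \<times> 'p)"
  where "translation cm u = Blinfun (\<lambda>(m, p). (m, p + cm u m))"

definition inv_translation ::
    "(real^8 \<Rightarrow> 'p::euclidean_space \<Rightarrow> 'm::euclidean_space) \<Rightarrow> real^8 \<Rightarrow> ('m \<times> 'p) \<Rightarrow>\<^sub>L ('m \<times> 'p)"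
  where "inv_translation cp u = Blinfun (\<lambda>(m, p). (m + cp u p, p))"

definition Spin91 ::
    "(real^8 \<Rightarrow> 'm::euclidean_space \<Rightarrow> 'p::euclidean_space) \<Rightarrow> (real^8 \<Rightarrow> 'p \<Rightarrow> 'm) \<Rightarrow>
     (('m \<times> 'p) \<Rightarrow>\<^sub>L ('m \<times> 'p)) monoid"
  where "Spin91 cm cp =
    GL_group\<lparr>carrier := generate GL_group (range (translation cm) \<union> range (inv_translation cp))\<rparr>"

definition GL2 :: "(real^2^2) monoid"
  where "GL2 = \<lparr>carrier = {A. invertible A}, mult = (**), one = mat 1\<rparr>"

definition GL2_pos :: "(real^2^2) monoid"
  where "GL2_pos = GL2\<lparr>carrier := {A. det A > 0}\<rparr>"

definition SL2 :: "(real^2^2) monoid"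
  where "SL2 = GL2\<lparr>carrier := {A. det A = 1}\<rparr>"

text \<open>The maps \<open>translation cm u\<close> and \<open>inv_translation cp u\<close> generate \<open>(m, p) \<mapsto> (cp u p, cm u m)\<close> for unit
  vectors \<open>u\<close>; the product of these over an orthonormal basis of \<open>R\<^sup>8\<close> is \<open>(m, p) \<mapsto> (m, - p)\<close> up to sign.
  Paired with plus or minus the matrix \<open>diag (1, - 1)\<close> it fixes \<open>((m, 0), (0, p))\<close>. Stabilizers in
  \<open>Spin91 cm cp \<times>\<times> GL2\<close> therefore contain elements with \<open>det A = - 1\<close>, which makes them disconnected,
  and the factor \<^term>\<open>SL2\<close> is enlarged to the following group unless \<^term>\<open>GL2\<close> is replaced by
  \<^term>\<open>GL2_pos\<close>.\<close>

definition SL2_pm :: "(real^2^2) monoid"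
  where "SL2_pm = GL2\<lparr>carrier := {A. det A = 1 \<or> det A = - 1}\<rparr>"

fun twistor_act ::
    "(('m::euclidean_space \<times> 'p::euclidean_space) \<Rightarrow>\<^sub>L ('m \<times> 'p)) \<times> (real^2^2) \<Rightarrow>
     ('m \<times> 'p) \<times> ('m \<times> 'p) \<Rightarrow> ('m \<times> 'p) \<times> ('m \<times> 'p)"
  where "twistor_act (g, A) (\<psi>1, \<psi>2) =
    (A $ 1 $ 1 *\<^sub>R blinfun_apply g \<psi>1 + A $ 1 $ 2 *\<^sub>R blinfun_apply g \<psi>2,
     A $ 2 $ 1 *\<^sub>R blinfun_apply g \<psi>1 + A $ 2 $ 2 *\<^sub>R blinfun_apply g \<psi>2)"


subsection \<open>Octonions and their automorphisms\<close>

text \<open>Both multiplications are the Cayley-Dickson product \<open>(a, b) (c, d) = (a c - d\<^sup>* b, d a + b c\<^sup>*)\<close>.\<close>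

type_synonym quat = "complex \<times> complex"
type_synonym oct = "quat \<times> quat"

fun qcnj :: "quat \<Rightarrow> quat"
  where "qcnj (a, b) = (cnj a, - b)"

fun qmult :: "quat \<Rightarrow> quat \<Rightarrow> quat"
  where "qmult (a, b) (c, d) = (a * c - cnj d * b, d * a + b * cnj c)"

fun omult :: "oct \<Rightarrow> oct \<Rightarrow> oct"
  where "omult (a, b) (c, d) =
    (qmult a c - qmult (qcnj d) b, qmult d a + qmult b (qcnj c))"

definition G2 :: "(oct \<Rightarrow>\<^sub>L oct) monoid"
  where "G2 = GL_group\<lparr>carrier := {f \<in> carrier GL_group.
    \<forall>x y. blinfun_apply f (omult x y) = omult (blinfun_apply f x) (blinfun_apply f y)}\<rparr>"


subsection \<open>Isomorphisms of topological groups\<close>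

text \<open>All groups here are closed subgroups of products of general linear groups, so an isomorphism of
  topological groups is the same as an isomorphism of Lie groups.\<close>

definition top_group_iso ::
    "('a::topological_space) monoid \<Rightarrow> ('b::topological_space) monoid \<Rightarrow> ('a \<Rightarrow> 'b) \<Rightarrow> bool"
  where "top_group_iso G H \<Phi> \<longleftrightarrow>
    \<Phi> \<in> iso G H \<and> (\<exists>\<Psi>. homeomorphism (carrier G) (carrier H) \<Phi> \<Psi>)"

definition stabilizer_group ::
    "((('m::euclidean_space \<times> 'p::euclidean_space) \<Rightarrow>\<^sub>L ('m \<times> 'p)) \<times> (real^2^2)) monoid \<Rightarrow>
     ('m \<times> 'p) \<times> ('m \<times> 'p) \<Rightarrow> ((('m \<times> 'p) \<Rightarrow>\<^sub>L ('m \<times> 'p)) \<times> (real^2^2)) monoid"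
  where "stabilizer_group G \<rho> = G\<lparr>carrier := stabilizer G twistor_act \<rho>\<rparr>"

end

theory Submission
  imports Defs
begin

text \<open>Why the theorem holds. A twistor \<open>\<psi> = (\<phi>\<^sup>-, \<phi>\<^sup>+)\<close> has a quadratic image
\<open>(|\<phi>\<^sup>-|\<^sup>2, 2 \<phi>\<^sup>- \<cdot> \<phi>\<^sup>+, |\<phi>\<^sup>+|\<^sup>2)\<close> in \<open>R\<^sup>9\<^sup>,\<^sup>1\<close>, the coefficients of the function \<open>\<langle>\<psi>(x), \<psi>(x)\<rangle>\<close>.
Every translation and every inverted translation acts on these triples by a linear Lorentz
isometry (\<open>Spin_lorentz\<close>). The determinant of \<open>(\<psi>\<^sub>1, \<psi>\<^sub>2)\<close> is built from the Lorentz products of the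
polarised triples, so it is \<open>Spin(9,1)\<close>-invariant, and \<open>GL(2,R)\<close> multiplies it by \<open>(det A)\<^sup>2\<close>.

For (i), writing \<open>\<phi>\<^sub>a\<^sup>+ = - c\<^sub>a \<cdot> \<phi>\<^sub>a\<^sup>-\<close> turns the determinant into
\<open>|\<phi>\<^sub>1\<^sup>-|\<^sup>2 |\<phi>\<^sub>2\<^sup>-|\<^sup>2 |c\<^sub>1 - c\<^sub>2|\<^sup>2\<close>, where \<open>c\<^sub>a\<close> is the projection of \<open>\<psi>\<^sub>a\<close>.

For (ii), a translation and an inverted translation move the two projections to \<open>0\<close> and \<open>\<infinity>\<close>,
so that \<open>\<rho> = ((m, 0), (0, p))\<close>; a diagonal matrix makes \<open>m\<close> and \<open>p\<close> unit vectors, and products of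
Clifford multiplications by unit vectors act transitively on pairs of unit spinors
(\<open>orbit_normal_form\<close>).

For (iii), fix unit vectors \<open>x\<^sub>0\<close>, \<open>m\<^sub>0\<close> and set \<open>p\<^sub>0 = x\<^sub>0 \<cdot> m\<^sub>0\<close>. The Clifford product \<open>R\<^sup>8 \<times> S\<^sup>- \<rightarrow> S\<^sup>+\<close>
becomes an eight-dimensional composition algebra with unit \<open>p\<^sub>0\<close>, and Hurwitz' doubling argument
identifies it with the octonions. In these coordinates \<open>T = O \<otimes> R\<^sup>2\<close>, and the base point
\<open>\<rho>\<^sub>0 = ((m\<^sub>0, 0), (0, p\<^sub>0))\<close> consists of the two vectors \<open>1 \<otimes> e\<^sub>a\<close>. The matrices with determinant
\<open>\<plusminus> 1\<close> acting on the factor \<open>R\<^sup>2\<close> lie in \<open>Spin(9,1)\<close> and commute with the octonion automorphisms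
acting on the factor \<open>O\<close>. If \<open>(g, A)\<close> stabilizes \<open>\<rho>\<^sub>0\<close>, then \<open>det A = \<plusminus> 1\<close> by invariance, and undoing
\<open>A\<close> on the factor \<open>R\<^sup>2\<close> leaves an element that fixes both components of \<open>\<rho>\<^sub>0\<close>. Its Lorentz isometry
fixes two null vectors, hence splits off an isometry \<open>\<sigma>\<close> of \<open>R\<^sup>8\<close>; the element is then block
diagonal and forms a triality with \<open>\<sigma>\<close>, and a triality that fixes the units is an octonion
automorphism (\<open>pointwise_stabilizer\<close>). Conversely every triality, in particular every octonion
automorphism, belongs to \<open>Spin(9,1)\<close> (\<open>triality_in_Spin\<close>). Other base points follow by conjugation.\<close>

section \<open>Composition algebras and the octonions\<close>

text \<open>Multiplicativity of the norm stands in for the associative law: it yields the two cancellation laws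
\<open>left_cancel\<close> and \<open>right_cancel\<close>, on which Hurwitz' argument rests.\<close>

locale composition_algebra =
  fixes mul :: "'a::euclidean_space \<Rightarrow> 'a \<Rightarrow> 'a" and unit :: 'a
  assumes bilinear_mul: "bilinear mul"
    and norm_mul: "norm (mul a b) = norm a * norm b"
    and unit_left: "mul unit a = a"
    and unit_right: "mul a unit = a"
    and norm_unit: "norm unit = 1"
begin

definition conj :: "'a \<Rightarrow> 'a" where "conj a = (2 * (a \<bullet> unit)) *\<^sub>R unit - a"

lemmas mul_simps =
  bilinear_ladd[OF bilinear_mul] bilinear_radd[OF bilinear_mul] bilinear_lsub[OF bilinear_mul]
  bilinear_rsub[OF bilinear_mul] bilinear_lmul[OF bilinear_mul] bilinear_rmul[OF bilinear_mul]
  bilinear_lneg[OF bilinear_mul] bilinear_rneg[OF bilinear_mul] bilinear_lzero[OF bilinear_mul]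
  bilinear_rzero[OF bilinear_mul] unit_left unit_right

lemma unit_inner: "unit \<bullet> unit = 1"
  using norm_unit by (simp add: norm_eq_1)

lemma inner_mul_self: "mul a b \<bullet> mul a b = (a \<bullet> a) * (b \<bullet> b)"
  using norm_mul[of a b] by (metis dot_square_norm power_mult_distrib)

lemma inner_mul_left: "mul a b \<bullet> mul a c = (a \<bullet> a) * (b \<bullet> c)"
  using inner_mul_self[of a "b + c"] inner_mul_self[of a b] inner_mul_self[of a c]
  by (simp add: mul_simps inner_add_left inner_add_right inner_commute algebra_simps)

lemma inner_mul_right: "mul a c \<bullet> mul b c = (a \<bullet> b) * (c \<bullet> c)"
  using inner_mul_self[of "a + b" c] inner_mul_self[of a c] inner_mul_self[of b c]
  by (simp add: mul_simps inner_add_left inner_add_right inner_commute algebra_simps)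

text \<open>Polarising \<open>|a b|\<^sup>2 = |a|\<^sup>2 |b|\<^sup>2\<close> in both arguments. All identities below come from this one by
inserting the unit and by nondegeneracy of the inner product.\<close>

lemma inner_exchange: "mul a c \<bullet> mul b d + mul a d \<bullet> mul b c = 2 * (a \<bullet> b) * (c \<bullet> d)"
  using inner_mul_right[of a "c + d" b] inner_mul_right[of a c b] inner_mul_right[of a d b]
  by (simp add: mul_simps inner_add_left inner_add_right inner_commute algebra_simps)

lemma adjoint_left: "mul a b \<bullet> c = b \<bullet> mul (conj a) c"
  using inner_exchange[of a b unit c]
  by (simp add: conj_def mul_simps inner_diff_right inner_diff_left inner_commute)

lemma adjoint_right: "mul a b \<bullet> c = a \<bullet> mul c (conj b)"
  using inner_exchange[of a b c unit]
  by (simp add: conj_def mul_simps inner_diff_right inner_diff_left inner_commute algebra_simps)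

lemma conj_conj [simp]: "conj (conj a) = a"
  by (simp add: conj_def inner_diff_left unit_inner algebra_simps)

lemma conj_add: "conj (a + b) = conj a + conj b"
  by (simp add: conj_def algebra_simps)

lemma conj_inner: "conj a \<bullet> conj b = a \<bullet> b"
  by (simp add: conj_def inner_diff_left inner_diff_right unit_inner inner_commute)

lemma conj_inner_swap: "conj a \<bullet> b = a \<bullet> conj b"
  by (metis conj_conj conj_inner)

lemma conj_mul: "conj (mul a b) = mul (conj b) (conj a)"
proof (rule inner_commute[THEN trans, THEN vector_eq_rdot[THEN iffD1, OF allI]])
  fix t
  have "conj (mul a b) \<bullet> t = mul a b \<bullet> conj t"
    by (rule conj_inner_swap)
  also have "\<dots> = b \<bullet> mul (conj a) (conj t)"
    by (rule adjoint_left)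
  also have "\<dots> = mul b t \<bullet> conj a"
    by (rule adjoint_right[symmetric])
  also have "\<dots> = t \<bullet> mul (conj b) (conj a)"
    by (rule adjoint_left)
  finally show "t \<bullet> conj (mul a b) = mul (conj b) (conj a) \<bullet> t"
    by (simp add: inner_commute)
qed

lemma left_cancel: "mul (conj a) (mul a b) = (a \<bullet> a) *\<^sub>R b"
proof -
  have "t \<bullet> mul (conj a) (mul a b) = t \<bullet> (a \<bullet> a) *\<^sub>R b" for t
    using inner_mul_left[of a t b] adjoint_left[of a t "mul a b"] by simp
  then show ?thesis using vector_eq_ldot by blast
qed

lemma right_cancel: "mul (mul a b) (conj b) = (b \<bullet> b) *\<^sub>R a"
proof -
  have "t \<bullet> mul (mul a b) (conj b) = t \<bullet> (b \<bullet> b) *\<^sub>R a" for t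
    using inner_mul_right[of t b a] adjoint_right[of t b "mul a b"] by simp
  then show ?thesis using vector_eq_ldot by blast
qed

lemma left_cancel2: "mul (conj x) (mul y b) + mul (conj y) (mul x b) = (2 * (x \<bullet> y)) *\<^sub>R b"
  using left_cancel[of "x + y" b] left_cancel[of x b] left_cancel[of y b]
  by (simp add: mul_simps conj_add inner_add_left inner_add_right inner_commute algebra_simps
      flip: scaleR_2)

lemma right_cancel2: "mul (mul b x) (conj y) + mul (mul b y) (conj x) = (2 * (x \<bullet> y)) *\<^sub>R b"
  using right_cancel[of b "x + y"] right_cancel[of b x] right_cancel[of b y]
  by (simp add: mul_simps conj_add inner_add_left inner_add_right inner_commute algebra_simps
      flip: scaleR_2)

end

text \<open>One stage of the doubling process: an algebra with involution embedded isometrically in the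
composition algebra, with the involution carried to octonionic conjugation \<open>conj\<close>. The algebra \<open>'x\<close>
is given by bare functions \<open>m\<close> and \<open>c\<close> so that the complex numbers, the quaternions and the octonions
all fit.\<close>

locale subalgebra_embedding = composition_algebra mul unit
  for mul :: "'a::euclidean_space \<Rightarrow> 'a \<Rightarrow> 'a" and unit :: 'a +
  fixes m :: "'x::euclidean_space \<Rightarrow> 'x \<Rightarrow> 'x" and c :: "'x \<Rightarrow> 'x" and f :: "'x \<Rightarrow> 'a" and u :: 'x
  assumes lin: "linear f"
    and iso: "f a \<bullet> f b = a \<bullet> b"
    and hom: "f (m a b) = mul (f a) (f b)"
    and conj: "f (c a) = conj (f a)"
    and unit: "f u = unit"
begin

text \<open>Hurwitz' doubling step. If \<open>e\<close> is a unit vector orthogonal to the embedded algebra \<open>B\<close>, then \<open>B e\<close> is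
orthogonal to \<open>B\<close>, every element of \<open>B e\<close> is anti-selfconjugate, and the linearised cancellation laws
force the products of \<open>B\<close> and \<open>B e\<close> to be the Cayley-Dickson ones. The product on the doubled algebra
has the shape used for quaternions and octonions, so the lemma can be iterated.\<close>

lemma doubling:
  assumes e: "norm e = 1" "\<And>a. f a \<bullet> e = 0"
  defines "f' \<equiv> (\<lambda>(a, b). f a + mul (f b) e)"
  shows "subalgebra_embedding mul unit
    (\<lambda>(a, b) (c', d). (m a c' - m (c d) b, m d a + m b (c c'))) (\<lambda>(a, b). (c a, - b)) f' (u, 0)"
proof -
  have ee: "e \<bullet> e = 1" using e by (simp add: norm_eq_1)
  have e0: "e \<bullet> unit = 0" using e(2)[of u] unit by (simp add: inner_commute)
  have ce: "conj e = - e" using e0 by (simp add: conj_def)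
  have orth: "mul (f b) e \<bullet> f a = 0" for a b
  proof -
    have "mul (f b) e \<bullet> f a = e \<bullet> f (m (c b) a)"
      by (simp add: adjoint_left hom conj)
    then show ?thesis using e(2) by (simp add: inner_commute)
  qed
  have cbe: "conj (mul (f b) e) = - mul (f b) e" for b
    using orth[of b u] by (simp add: unit conj_def)
  \<comment> \<open>Elements of \<open>B\<close> can be moved past \<open>e\<close> at the price of a conjugation.\<close>
  have swap: "mul (f b) e = mul e (conj (f b))" for b
  proof -
    have "conj (mul (f b) e) = - mul e (conj (f b))"
      by (simp add: conj_mul ce mul_simps)
    then show ?thesis using cbe[of b] by simp
  qed
  have right: "mul (mul (f b) e) (f x) = mul (mul (f b) (conj (f x))) e" for b x
    using right_cancel2[of "f b" e "conj (f x)"] e(2)[of "c x"]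
    by (simp add: ce mul_simps conj inner_commute)
  have left: "mul (f x) (mul (f d) e) = mul (mul (f d) (f x)) e" for x d
  proof -
    have "mul (f x) (mul e (conj (f d))) = mul e (mul (conj (f x)) (conj (f d)))"
      using left_cancel2[of "conj (f x)" e "conj (f d)"] e(2)[of "c x"]
      by (simp add: ce mul_simps conj)
    also have "\<dots> = mul e (conj (f (m d x)))"
      by (simp add: conj_mul hom)
    also have "\<dots> = mul (mul (f d) (f x)) e"
      using swap[of "m d x"] by (simp add: hom)
    finally show ?thesis using swap[of d] by simp
  qed
  have both: "mul (mul (f b) e) (mul (f d) e) = - mul (conj (f d)) (f b)" for b d
  proof -
    have "mul (mul (f b) e) (mul e (conj (f d))) + mul e (mul (mul (f b) e) (conj (f d)))
        = - (2 * (f b \<bullet> unit)) *\<^sub>R conj (f d)"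
    proof -
      have "mul (f b) e \<bullet> e = f b \<bullet> unit"
        using inner_mul_right[of "f b" e unit] by (simp add: unit_left ee)
      moreover have "conj (- mul (f b) e) = mul (f b) e"
        by (metis cbe conj_conj)
      ultimately show ?thesis
        using left_cancel2[of "- mul (f b) e" e "conj (f d)"] ce by (simp add: mul_simps)
    qed
    moreover have "mul e (mul (mul (f b) e) (conj (f d))) = - conj (f (m b d))"
    proof -
      have "mul (mul (f b) e) (conj (f d)) = mul (f (m b d)) e"
        using right[of b "c d"] by (simp add: conj hom)
      also have "\<dots> = mul e (conj (f (m b d)))"
        by (rule swap)
      finally have "mul (mul (f b) e) (conj (f d)) = mul e (conj (f (m b d)))" .
      moreover have "- mul e (mul e (conj (f (m b d)))) = conj (f (m b d))"
        using left_cancel[of e "conj (f (m b d))"] by (simp add: ce ee mul_simps)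
      ultimately show ?thesis
        by (metis minus_minus)
    qed
    ultimately have "mul (mul (f b) e) (mul (f d) e)
        = mul (conj (f d)) (conj (f b)) - (2 * (f b \<bullet> unit)) *\<^sub>R conj (f d)"
      using swap[of d] by (simp add: hom conj_mul algebra_simps)
    also have "\<dots> = - mul (conj (f d)) (f b)"
      by (subst (2) conj_def) (simp add: mul_simps algebra_simps)
    finally show ?thesis .
  qed
  show ?thesis
  proof (intro subalgebra_embedding.intro subalgebra_embedding_axioms.intro
      composition_algebra_axioms)
    show "linear f'"
      unfolding f'_def by (rule linearI)
        (auto simp: linear_add[OF lin] linear_scale[OF lin] mul_simps algebra_simps)
    show "f' a \<bullet> f' b = a \<bullet> b" for a b
      by (cases a; cases b) (simp add: f'_def inner_add_left inner_add_right iso orth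
          inner_mul_right ee inner_commute[of "f _" "mul _ _"])
    show "f' ((\<lambda>(a, b) (c', d). (m a c' - m (c d) b, m d a + m b (c c'))) a b) = mul (f' a) (f' b)"
      for a b
      by (cases a; cases b) (simp add: f'_def mul_simps left right both hom conj
          linear_add[OF lin] linear_diff[OF lin] algebra_simps)
    show "f' ((\<lambda>(a, b). (c a, - b)) a) = conj (f' a)" for a
      by (cases a) (simp add: f'_def conj conj_add cbe linear_neg[OF lin] mul_simps)
    show "f' (u, 0) = unit"
      by (simp add: f'_def unit linear_0[OF lin] mul_simps)
  qed
qed

end

lemma (in composition_algebra) unit_orthogonal_exists:
  fixes f :: "'x::euclidean_space \<Rightarrow> 'a"
  assumes "linear f" "DIM('x) < DIM('a)"
  obtains e where "norm e = 1" "\<And>a. f a \<bullet> e = 0"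
proof -
  have "dim (range f) < DIM('a)"
    using dim_image_le[OF assms(1), of UNIV] assms(2) by (simp add: dim_UNIV)
  then obtain x where x: "x \<noteq> 0" "\<And>y. y \<in> span (range f) \<Longrightarrow> orthogonal x y"
    using orthogonal_to_subspace_exists[of "range f"] by blast
  show ?thesis
  proof (rule that[of "x /\<^sub>R norm x"])
    show "norm (x /\<^sub>R norm x) = 1" using x(1) by simp
    show "f a \<bullet> (x /\<^sub>R norm x) = 0" for a
      using x(2)[of "f a"] by (simp add: orthogonal_def inner_commute span_base)
  qed
qed

definition oone :: oct where "oone = ((1, 0), (0, 0))"

text \<open>Start from the reals and adjoin orthogonal units \<open>i\<close>, \<open>j\<close>, \<open>l\<close> in turn; there is room for each because
the algebras reached before have dimension 1, 2 and 4. An isometric embedding between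
eight-dimensional spaces is bijective, so this is an isomorphism.\<close>

theorem (in composition_algebra) octonion_embedding:
  assumes "DIM('a) = 8"
  obtains f :: "oct \<Rightarrow> 'a" where "linear f" "\<And>a b. f a \<bullet> f b = a \<bullet> b"
    "\<And>a b. f (omult a b) = mul (f a) (f b)" "f oone = unit"
proof -
  have "linear (\<lambda>r::real. r *\<^sub>R unit)"
    by (simp add: linear_iff algebra_simps)
  then obtain i where i: "norm i = 1" "\<And>a. (a *\<^sub>R unit) \<bullet> i = 0"
    using unit_orthogonal_exists[of "\<lambda>r::real. r *\<^sub>R unit"] assms by auto
  define f1 where "f1 z = Re z *\<^sub>R unit + Im z *\<^sub>R i" for z
  have ii: "i \<bullet> i = 1" "unit \<bullet> i = 0" "i \<bullet> unit = 0"
    using i(1) i(2)[of 1] by (auto simp: norm_eq_1 inner_commute)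
  have "- mul i i = unit"
    using left_cancel[of i unit] ii by (simp add: mul_simps conj_def)
  then have "mul i i = - unit"
    by (metis minus_minus)
  then have 1: "subalgebra_embedding mul unit times cnj f1 1"
    using ii unit_inner by unfold_locales
      (auto simp: f1_def linear_iff algebra_simps mul_simps inner_complex_def conj_def simp flip: scaleR_2)
  then interpret c: subalgebra_embedding mul unit times cnj f1 1 .
  obtain j where j: "norm j = 1" "\<And>a. f1 a \<bullet> j = 0"
    using unit_orthogonal_exists[OF c.lin] assms by auto
  have q: "qmult = (\<lambda>(a, b) (c', d). (a * c' - cnj d * b, d * a + b * cnj c'))"
    "qcnj = (\<lambda>(a, b). (cnj a, - b))"
    by (auto simp: fun_eq_iff)
  from c.doubling[OF j] obtain f2 where "subalgebra_embedding mul unit qmult qcnj f2 (1, 0)"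
    unfolding q by blast
  then interpret q: subalgebra_embedding mul unit qmult qcnj f2 "(1, 0)" .
  obtain l where l: "norm l = 1" "\<And>a. f2 a \<bullet> l = 0"
    using unit_orthogonal_exists[OF q.lin] assms by auto
  have o: "omult = (\<lambda>(a, b) (c', d). (qmult a c' - qmult (qcnj d) b, qmult d a + qmult b (qcnj c')))"
    by (auto simp: fun_eq_iff)
  from q.doubling[OF l] obtain f3 c3
    where "subalgebra_embedding mul unit omult c3 f3 ((1, 0), 0)"
    unfolding o by blast
  then interpret o: subalgebra_embedding mul unit omult c3 f3 "((1, 0), 0)" .
  show ?thesis
    using that o.lin o.iso o.hom o.unit by (simp add: oone_def zero_prod_def)
qed

text \<open>The quadratic equation of an octonion. An automorphism preserves it, which is why automorphisms are
isometric.\<close>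

lemma omult_quadratic:
  "omult x x + (x \<bullet> x) *\<^sub>R oone = (2 * (x \<bullet> oone)) *\<^sub>R x"
proof -
  obtain a b c d where "x = ((a, b), (c, d))" by (metis surj_pair)
  then show ?thesis
    by (simp add: oone_def complex_eq_iff inner_complex_def algebra_simps power2_eq_square)
qed

lemma omult_one [simp]: "omult oone x = x" "omult x oone = x"
  by (cases x; cases "fst x"; cases "snd x"; auto simp: oone_def)+

text \<open>Testing on pairs of the basis units \<open>i\<close>, \<open>j\<close>, \<open>l\<close>, \<open>j l\<close> already kills every imaginary coordinate
of an element that associates on the right with all pairs. This replaces Schur's lemma for the
spin modules: an intertwiner of Clifford multiplication is right multiplication by such an element.\<close>

lemma omult_nucleus:
  assumes "\<And>x m. omult (omult x m) a = omult x (omult m a)"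
  shows "a = (a \<bullet> oone) *\<^sub>R oone"
proof -
  obtain a1 a2 a3 a4 where a: "a = ((a1, a2), (a3, a4))" by (metis surj_pair)
  show ?thesis
    using assms[of "((\<i>, 0), (0, 0))" "((0, 1), (0, 0))"] assms[of "((\<i>, 0), (0, 0))" "((0, 0), (1, 0))"]
      assms[of "((0, 1), (0, 0))" "((0, 0), (1, 0))"] assms[of "((\<i>, 0), (0, 0))" "((0, 0), (0, 1))"]
    by (auto simp: a oone_def complex_eq_iff inner_complex_def zero_prod_def)
qed

text \<open>With the order of the factors \<open>x\<close> and \<open>m\<close> exchanged the same tests also kill the real coordinate. This
is what prevents an orientation-reversing isometry of \<open>R\<^sup>8\<close> from being covered by maps that preserve
\<open>S\<^sup>-\<close> and \<open>S\<^sup>+\<close>.\<close>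

lemma omult_twisted_nucleus:
  assumes "\<And>x m. omult (omult m x) a = omult x (omult m a)"
  shows "a = 0"
proof -
  obtain a1 a2 a3 a4 where a: "a = ((a1, a2), (a3, a4))" by (metis surj_pair)
  show ?thesis
    using assms[of "((\<i>, 0), (0, 0))" "((0, 1), (0, 0))"] assms[of "((\<i>, 0), (0, 0))" "((0, 0), (1, 0))"]
      assms[of "((0, 1), (0, 0))" "((0, 0), (1, 0))"] assms[of "((\<i>, 0), (0, 0))" "((0, 0), (0, 1))"]
    by (auto simp: a complex_eq_iff inner_complex_def zero_prod_def)
qed

text \<open>If \<open>y = s x\<close>, then \<open>y\<close> satisfies both its own quadratic equation and the image of that of \<open>x\<close>. Their
difference is linear in \<open>y\<close>, so either the coefficients agree or \<open>y\<close> is real, and then \<open>x = y\<close>.\<close>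

lemma G2_norm:
  assumes "s \<in> carrier G2"
  shows "blinfun_apply s oone = oone" "blinfun_apply s a \<bullet> blinfun_apply s b = a \<bullet> b"
proof -
  from assms obtain t where t: "s o\<^sub>L t = id_blinfun" "t o\<^sub>L s = id_blinfun"
    and hom: "\<And>x y. s (omult x y) = omult (s x) (s y)"
    by (auto simp: G2_def GL_group_def)
  have st: "s (t x) = x" and ts: "t (s x) = x" for x
    by (metis t blinfun_apply_blinfun_compose blinfun_apply_id_blinfun)+
  show 1: "s oone = oone"
    using hom[of oone "t oone"] by (simp add: st)
  have sq: "s x \<bullet> s x = x \<bullet> x" for x
  proof -
    let ?y = "s x"
    have "s (omult x x + (x \<bullet> x) *\<^sub>R oone) = s ((2 * (x \<bullet> oone)) *\<^sub>R x)"
      by (simp only: omult_quadratic)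
    then have "omult ?y ?y + (x \<bullet> x) *\<^sub>R oone = (2 * (x \<bullet> oone)) *\<^sub>R ?y"
      by (simp only: blinfun.add_right blinfun.scaleR_right hom 1)
    with omult_quadratic[of ?y]
    have eq: "(2 * (?y \<bullet> oone - x \<bullet> oone)) *\<^sub>R ?y = (?y \<bullet> ?y - x \<bullet> x) *\<^sub>R oone"
      unfolding scaleR_diff_left right_diff_distrib by (metis add_diff_cancel_left)
    show ?thesis
    proof (cases "?y \<bullet> oone = x \<bullet> oone")
      case True
      with eq have "(?y \<bullet> ?y - x \<bullet> x) *\<^sub>R oone = 0" by (simp only: diff_self mult_zero_right scaleR_zero_left)
      then show ?thesis by (simp add: oone_def zero_prod_def)
    next
      case False
      \<comment> \<open>Here \<open>y\<close> is a real multiple of the unit, and \<open>s\<close> fixes such elements.\<close>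
      define r where "r = (?y \<bullet> ?y - x \<bullet> x) / (2 * (?y \<bullet> oone - x \<bullet> oone))"
      have "?y = r *\<^sub>R oone"
      proof -
        have "inverse (2 * (?y \<bullet> oone - x \<bullet> oone)) *\<^sub>R ((2 * (?y \<bullet> oone - x \<bullet> oone)) *\<^sub>R ?y) = r *\<^sub>R oone"
          unfolding eq r_def by (simp add: divide_inverse mult.commute)
        with False show ?thesis by simp
      qed
      moreover have "s (r *\<^sub>R oone) = r *\<^sub>R oone" by (simp only: blinfun.scaleR_right 1)
      ultimately have "x = r *\<^sub>R oone" by (metis ts)
      with \<open>?y = r *\<^sub>R oone\<close> show ?thesis by simp
    qed
  qed
  show "s a \<bullet> s b = a \<bullet> b"
    using sq[of "a + b"] sq[of a] sq[of b]
    by (simp add: blinfun.add_right inner_add_left inner_add_right inner_commute)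
qed

section \<open>Half-spin modules and the quadratic map to Lorentz space\<close>

lemma linear_inj_imp_surj_equal_dim:
  fixes f :: "'a::euclidean_space \<Rightarrow> 'b::euclidean_space"
  assumes "linear f" "inj f" "DIM('a) = DIM('b)"
  shows "surj f"
proof -
  have "dim (range f) = DIM('b)"
    using dim_image_eq[of f UNIV] assms by (simp add: dim_UNIV)
  then have "span (range f) = UNIV" by (simp only: dim_eq_full)
  moreover have "span (range f) = range f"
    using assms(1) by (simp add: linear_subspace_image)
  ultimately show ?thesis by simp
qed

lemma linear_isometry_bij:
  fixes f :: "'a::euclidean_space \<Rightarrow> 'b::euclidean_space"
  assumes "linear f" "\<And>x y. f x \<bullet> f y = x \<bullet> y" "DIM('a) = DIM('b)"
  shows "bij f"
proof -
  have "inj f"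
  proof (rule injI)
    fix x y assume eq: "f x = f y"
    have "(x - y) \<bullet> (x - y) = f (x - y) \<bullet> f (x - y)" by (simp add: assms(2))
    also have "\<dots> = 0" by (simp add: linear_diff[OF assms(1)] eq)
    finally show "x = y" by simp
  qed
  then show ?thesis
    using linear_inj_imp_surj_equal_dim[OF assms(1) _ assms(3)] by (simp add: bij_def)
qed

text \<open>The Lorentz form on coefficient triples of \<open>k |x|\<^sup>2 + \<langle>x, b\<rangle> + c\<close>.\<close>

fun lform :: "real \<times> (real^8) \<times> real \<Rightarrow> real \<times> (real^8) \<times> real \<Rightarrow> real"
  where "lform (k, b, c) (k', b', c') = b \<bullet> b' - 2 * (k * c' + k' * c)"

lemma bilinear_lform: "bilinear lform"
  unfolding bilinear_def by (auto intro!: linearI simp: inner_add_left inner_add_right algebra_simps)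

lemma lform_commute: "lform s t = lform t s"
  by (cases s; cases t) (simp add: inner_commute algebra_simps)

context half_spin
begin

lemmas cliff_simps =
  bilinear_ladd[OF bilinear_minus] bilinear_radd[OF bilinear_minus] bilinear_lsub[OF bilinear_minus]
  bilinear_rsub[OF bilinear_minus] bilinear_lmul[OF bilinear_minus] bilinear_rmul[OF bilinear_minus]
  bilinear_lneg[OF bilinear_minus] bilinear_rneg[OF bilinear_minus] bilinear_lzero[OF bilinear_minus]
  bilinear_rzero[OF bilinear_minus]
  bilinear_ladd[OF bilinear_plus] bilinear_radd[OF bilinear_plus] bilinear_lsub[OF bilinear_plus]
  bilinear_rsub[OF bilinear_plus] bilinear_lmul[OF bilinear_plus] bilinear_rmul[OF bilinear_plus]
  bilinear_lneg[OF bilinear_plus] bilinear_rneg[OF bilinear_plus] bilinear_lzero[OF bilinear_plus]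
  bilinear_rzero[OF bilinear_plus]

lemma linear_cm: "linear (\<lambda>x. cm x m)" "linear (cm x)"
  using bilinear_minus by (auto simp: bilinear_def)

lemma linear_cp: "linear (\<lambda>x. cp x p)" "linear (cp x)"
  using bilinear_plus by (auto simp: bilinear_def)

lemma skew': "cp x p \<bullet> m = - (p \<bullet> cm x m)"
  using skew[of x m p] by (simp add: inner_commute)

lemma cp_cm: "cp x (cm x m) = - (x \<bullet> x) *\<^sub>R m"
proof -
  have "2 *\<^sub>R cp x (cm x m) = 2 *\<^sub>R (- (x \<bullet> x) *\<^sub>R m)"
    using clifford_minus[of x x m] by (simp add: scaleR_2)
  then show ?thesis by (simp only: scaleR_cancel_left) simp
qed

lemma cm_cp: "cm x (cp x p) = - (x \<bullet> x) *\<^sub>R p"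
proof -
  have "2 *\<^sub>R cm x (cp x p) = 2 *\<^sub>R (- (x \<bullet> x) *\<^sub>R p)"
    using clifford_plus[of x x p] by (simp add: scaleR_2)
  then show ?thesis by (simp only: scaleR_cancel_left) simp
qed

lemma cm_exchange: "cm x m \<bullet> cm y n + cm y m \<bullet> cm x n = 2 * (x \<bullet> y) * (m \<bullet> n)"
proof -
  have "cm x m \<bullet> cm y n + cm y m \<bullet> cm x n = - (m \<bullet> (cp x (cm y n) + cp y (cm x n)))"
    by (simp add: skew inner_add_right)
  then show ?thesis by (simp add: clifford_minus)
qed

lemma cp_exchange: "cp x p \<bullet> cp y q + cp y p \<bullet> cp x q = 2 * (x \<bullet> y) * (p \<bullet> q)"
proof -
  have "cp x p \<bullet> cp y q + cp y p \<bullet> cp x q = - (p \<bullet> (cm x (cp y q) + cm y (cp x q)))"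
    by (simp add: skew' inner_add_right)
  then show ?thesis by (simp add: clifford_plus)
qed

lemma inner_cm: "cm x m \<bullet> cm y m = (x \<bullet> y) * (m \<bullet> m)"
  using cm_exchange[of x m y m] by (simp add: inner_commute)

lemma inner_cm': "cm x m \<bullet> cm x n = (x \<bullet> x) * (m \<bullet> n)"
  using cm_exchange[of x m x n] by simp

lemma inner_cp: "cp x p \<bullet> cp y p = (x \<bullet> y) * (p \<bullet> p)"
  using cp_exchange[of x p y p] by (simp add: inner_commute)

lemma inner_cp': "cp x p \<bullet> cp x q = (x \<bullet> x) * (p \<bullet> q)"
  using cp_exchange[of x p x q] by simp

lemma cm_eq_iff: "m \<noteq> 0 \<Longrightarrow> cm x m = cm y m \<longleftrightarrow> x = y"
  using inner_cm[of "x - y" m "x - y"] by (auto simp: cliff_simps)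

lemma cp_eq_iff: "p \<noteq> 0 \<Longrightarrow> cp x p = cp y p \<longleftrightarrow> x = y"
  using inner_cp[of "x - y" p "x - y"] by (auto simp: cliff_simps)

text \<open>Clifford multiplication on a nonzero spinor is a similarity between spaces of the same dimension 8.
This is what makes the Clifford product a composition algebra.\<close>

lemma cm_surj: "m \<noteq> 0 \<Longrightarrow> \<exists>x. cm x m = p"
  using linear_inj_imp_surj_equal_dim[OF linear_cm(1), of m] dim_plus
  by (auto simp: inj_def cm_eq_iff surj_def) metis

lemma cp_surj: "p \<noteq> 0 \<Longrightarrow> \<exists>x. cp x p = m"
  using linear_inj_imp_surj_equal_dim[OF linear_cp(1), of p] dim_minus
  by (auto simp: inj_def cp_eq_iff surj_def) metis

text \<open>The vector \<open>\<phi>\<^sup>- \<cdot> \<phi>\<^sup>+\<close>, characterised by \<open>inner_vp\<close>.\<close>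

definition vp :: "'m \<Rightarrow> 'p \<Rightarrow> real^8" where "vp m p = adjoint (\<lambda>x. cm x m) p"

lemma inner_vp: "x \<bullet> vp m p = cm x m \<bullet> p"
  unfolding vp_def by (rule adjoint_works[OF linear_cm(1)])

lemma bilinear_vp: "bilinear vp"
proof -
  have eq: "v = w" if "\<And>x. x \<bullet> v = x \<bullet> w" for v w :: "real^8"
    using that vector_eq_ldot by blast
  show ?thesis
    unfolding bilinear_def
    by (intro conjI allI linearI; rule eq)
      (simp_all add: inner_vp inner_add_right cliff_simps inner_add_left)
qed

lemma vp_cm: "vp m (cm y m) = (m \<bullet> m) *\<^sub>R y"
proof -
  have "x \<bullet> vp m (cm y m) = x \<bullet> (m \<bullet> m) *\<^sub>R y" for x
    by (simp add: inner_vp inner_cm)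
  then show ?thesis using vector_eq_ldot by blast
qed

text \<open>For \<open>m \<noteq> 0\<close> write \<open>p\<close> and \<open>q\<close> as Clifford products with \<open>m\<close>.\<close>

lemma inner_vp_vp: "vp m p \<bullet> vp m q = (m \<bullet> m) * (p \<bullet> q)"
proof (cases "m = 0")
  case False
  obtain y z where "p = cm y m" "q = cm z m" using cm_surj[OF False] by metis
  then show ?thesis by (simp add: vp_cm inner_cm)
qed (simp add: bilinear_lzero[OF bilinear_vp])

lemma vp_exchange: "vp m p \<bullet> vp n q + vp n p \<bullet> vp m q = 2 * (m \<bullet> n) * (p \<bullet> q)"
  using inner_vp_vp[of "m + n" p q] inner_vp_vp[of m p q] inner_vp_vp[of n p q]
  by (simp add: bilinear_ladd[OF bilinear_vp] inner_add_left inner_add_right inner_commute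
      algebra_simps)

text \<open>The polarised quadratic map \<open>T \<rightarrow> R\<^sup>9\<^sup>,\<^sup>1\<close>: the coefficients of \<open>x \<mapsto> \<langle>\<psi>(x), \<psi>'(x)\<rangle>\<close>.\<close>

fun tpair :: "'m \<times> 'p \<Rightarrow> 'm \<times> 'p \<Rightarrow> real \<times> (real^8) \<times> real"
  where "tpair (m, p) (n, q) = (m \<bullet> n, vp m q + vp n p, p \<bullet> q)"

lemma tpair_commute: "tpair \<psi> \<psi>' = tpair \<psi>' \<psi>"
  by (cases \<psi>; cases \<psi>') (simp add: inner_commute)

lemma bilinear_tpair: "bilinear tpair"
  unfolding bilinear_def
  by (auto intro!: linearI simp: inner_add_left inner_add_right
      bilinear_ladd[OF bilinear_vp] bilinear_radd[OF bilinear_vp]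
      bilinear_lmul[OF bilinear_vp] bilinear_rmul[OF bilinear_vp] algebra_simps)

lemma pairing_eq_quad_fun:
  "pairing cm (m, p) (n, q) = quad_fun (m \<bullet> n) (vp m q + vp n p) (p \<bullet> q)"
  by (rule ext) (simp add: pairing_def quad_fun_def inner_add_left inner_add_right inner_vp
      inner_cm' power2_norm_eq_inner inner_commute)

text \<open>The determinant as an expression in Lorentz products alone; invariance under \<open>Spin(9,1)\<close> and
covariance under \<open>GL(2,R)\<close> are read off from this form.\<close>

lemma twistor_det_eq:
  "twistor_det cm (\<psi>1, \<psi>2) =
    (lform (tpair \<psi>1 \<psi>2) (tpair \<psi>1 \<psi>2) - lform (tpair \<psi>1 \<psi>1) (tpair \<psi>2 \<psi>2)) / 3"
  by (cases \<psi>1; cases \<psi>2)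
    (simp add: twistor_det_def pairing_eq_quad_fun lorentz_quad_fun inner_commute add.commute)

text \<open>The exchange law for \<open>vp\<close> turns the mixed terms \<open>\<phi>\<^sub>1\<^sup>- \<cdot> \<phi>\<^sub>2\<^sup>+\<close> and \<open>\<phi>\<^sub>2\<^sup>- \<cdot> \<phi>\<^sub>1\<^sup>+\<close> into the diagonal ones;
the factor 3 in the definition of the determinant is the multiplicity that results.\<close>

lemma twistor_det_formula:
  "twistor_det cm ((m1, p1), (m2, p2)) =
    (m1 \<bullet> m1) * (p2 \<bullet> p2) + (m2 \<bullet> m2) * (p1 \<bullet> p1) - 2 * (vp m1 p1 \<bullet> vp m2 p2)"
  using vp_exchange[of m1 p2 m2 p1] inner_vp_vp[of m1 p2 p2] inner_vp_vp[of m2 p1 p1]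
  unfolding twistor_det_eq tpair.simps lform.simps inner_add_left inner_add_right
  by (simp add: inner_commute)

lemma open_det_nonzero: "open {\<rho>. twistor_det cm \<rho> \<noteq> 0}"
proof -
  have vp: "continuous_on UNIV (\<lambda>\<rho>. vp (f \<rho>) (g \<rho>))"
    if "continuous_on UNIV f" "continuous_on UNIV g" for f g :: "('m \<times> 'p) \<times> ('m \<times> 'p) \<Rightarrow> _"
    using bilinear_vp that by (intro bounded_bilinear.continuous_on[of vp])
      (auto simp: bilinear_conv_bounded_bilinear)
  have eq: "twistor_det cm = (\<lambda>\<rho>. (fst (fst \<rho>) \<bullet> fst (fst \<rho>)) * (snd (snd \<rho>) \<bullet> snd (snd \<rho>))
      + (fst (snd \<rho>) \<bullet> fst (snd \<rho>)) * (snd (fst \<rho>) \<bullet> snd (fst \<rho>))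
      - 2 * (vp (fst (fst \<rho>)) (snd (fst \<rho>)) \<bullet> vp (fst (snd \<rho>)) (snd (snd \<rho>))))"
    by (auto simp: fun_eq_iff twistor_det_formula)
  show ?thesis
    unfolding eq by (intro open_Collect_neq continuous_intros vp)
qed

lemma proj_Some:
  assumes "m \<noteq> 0"
  shows "proj cm (m, - cm c m) = Some c"
proof -
  have "(THE c'. \<forall>x. twistor_fun cm (m, - cm c m) x = cm (x - c') m) = c"
    using assms by (intro the_equality) (auto simp: cliff_simps cm_eq_iff)
  then show ?thesis using assms by (simp add: proj_def)
qed

text \<open>For two finite centres \<open>c\<^sub>1\<close>, \<open>c\<^sub>2\<close> the determinant is \<open>|m\<^sub>1|\<^sup>2 |m\<^sub>2|\<^sup>2 |c\<^sub>1 - c\<^sub>2|\<^sup>2\<close>. If \<open>m\<^sub>1 = 0\<close>, only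
\<open>|m\<^sub>2|\<^sup>2 |p\<^sub>1|\<^sup>2\<close> survives, and it vanishes exactly when \<open>\<psi>\<^sub>2\<close> also lies over infinity.\<close>

lemma det_zero_iff_proj_eq:
  assumes "\<psi>1 \<noteq> 0" "\<psi>2 \<noteq> 0"
  shows "twistor_det cm (\<psi>1, \<psi>2) = 0 \<longleftrightarrow> proj cm \<psi>1 = proj cm \<psi>2"
proof -
  obtain m1 p1 m2 p2 where \<psi>: "\<psi>1 = (m1, p1)" "\<psi>2 = (m2, p2)" by (metis surj_pair)
  have centre: "\<exists>c. p = - cm c m" if "m \<noteq> 0" for m p
    using cm_surj[OF that, of "- p"] by (metis minus_minus)
  show ?thesis
  proof (cases "m1 = 0 \<or> m2 = 0")
    case True
    have at_infinity: "proj cm (0, p) = None" "proj cm (m, p) = None \<longleftrightarrow> m = 0"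
        "None = proj cm (m, p) \<longleftrightarrow> m = 0" for m p
      by (auto simp: proj_def)
    show ?thesis
      using True assms by (auto simp: \<psi> twistor_det_formula bilinear_lzero[OF bilinear_vp]
          zero_prod_def at_infinity)
  next
    case False
    then obtain c1 c2 where c: "p1 = - cm c1 m1" "p2 = - cm c2 m2" using centre by metis
    have "twistor_det cm (\<psi>1, \<psi>2) = (m1 \<bullet> m1) * (m2 \<bullet> m2) * ((c1 - c2) \<bullet> (c1 - c2))"
      by (simp add: \<psi> c twistor_det_formula bilinear_rneg[OF bilinear_vp] vp_cm inner_cm
          inner_diff_left inner_diff_right inner_commute algebra_simps)
    with False show ?thesis by (simp add: \<psi> c proj_Some)
  qed
qed

text \<open>A formal identity: expanding both Lorentz products, the coefficients of \<open>lform r r\<close>, \<open>lform t t\<close>,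
\<open>lform r s\<close> and \<open>lform s t\<close> cancel, and the other two acquire the factor \<open>(a d - b c)\<^sup>2\<close>.\<close>

lemma det_linear_combination:
  "twistor_det cm (a *\<^sub>R \<psi>1 + b *\<^sub>R \<psi>2, c *\<^sub>R \<psi>1 + d *\<^sub>R \<psi>2)
    = (a * d - b * c)\<^sup>2 * twistor_det cm (\<psi>1, \<psi>2)"
proof -
  define r s t where "r = tpair \<psi>1 \<psi>1" and "s = tpair \<psi>1 \<psi>2" and "t = tpair \<psi>2 \<psi>2"
  have pair: "tpair (x *\<^sub>R \<psi>1 + y *\<^sub>R \<psi>2) (x' *\<^sub>R \<psi>1 + y' *\<^sub>R \<psi>2)
      = (x * x') *\<^sub>R r + (x * y' + y * x') *\<^sub>R s + (y * y') *\<^sub>R t" for x y x' y'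
    by (simp add: r_def s_def t_def tpair_commute[of \<psi>2 \<psi>1] bilinear_ladd[OF bilinear_tpair]
        bilinear_radd[OF bilinear_tpair] bilinear_lmul[OF bilinear_tpair]
        bilinear_rmul[OF bilinear_tpair] algebra_simps)
  have form: "lform (x *\<^sub>R r + y *\<^sub>R s + z *\<^sub>R t) (x' *\<^sub>R r + y' *\<^sub>R s + z' *\<^sub>R t)
      = x * x' * lform r r + y * y' * lform s s + z * z' * lform t t + (x * y' + y * x') * lform r s
        + (x * z' + z * x') * lform r t + (y * z' + z * y') * lform s t" for x y z x' y' z'
    by (simp add: bilinear_ladd[OF bilinear_lform] bilinear_radd[OF bilinear_lform]
        bilinear_lmul[OF bilinear_lform] bilinear_rmul[OF bilinear_lform]
        lform_commute[of s r] lform_commute[of t r] lform_commute[of t s] algebra_simps)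
  show ?thesis
    unfolding twistor_det_eq pair form unfolding r_def[symmetric] s_def[symmetric] t_def[symmetric]
    by (simp add: power2_eq_square algebra_simps add_divide_distrib diff_divide_distrib)
qed

end

lemma blinfun_compose_assoc: "(f o\<^sub>L g) o\<^sub>L h = f o\<^sub>L (g o\<^sub>L h)"
  by (rule blinfun_eqI) simp

lemma blinfun_compose_id [simp]: "f o\<^sub>L id_blinfun = f" "id_blinfun o\<^sub>L f = f"
  by (rule blinfun_eqI; simp)+

section \<open>The group generated by translations and inverted translations\<close>

lemma group_GL_group: "group (GL_group :: ('a::real_normed_vector \<Rightarrow>\<^sub>L 'a) monoid)"
proof (rule groupI)
  fix x assume "x \<in> carrier (GL_group :: ('a \<Rightarrow>\<^sub>L 'a) monoid)"
  then show "\<exists>y\<in>carrier GL_group. y \<otimes>\<^bsub>GL_group\<^esub> x = \<one>\<^bsub>GL_group\<^esub>"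
    by (auto simp: GL_group_def)
next
  fix x y :: "'a \<Rightarrow>\<^sub>L 'a"
  assume "x \<in> carrier GL_group" "y \<in> carrier GL_group"
  then obtain x' y' where "x o\<^sub>L x' = id_blinfun" "x' o\<^sub>L x = id_blinfun"
    "y o\<^sub>L y' = id_blinfun" "y' o\<^sub>L y = id_blinfun"
    by (auto simp: GL_group_def)
  then have "(x o\<^sub>L y) o\<^sub>L (y' o\<^sub>L x') = id_blinfun" "(y' o\<^sub>L x') o\<^sub>L (x o\<^sub>L y) = id_blinfun"
    by (metis blinfun_compose_assoc blinfun_compose_id)+
  then show "x \<otimes>\<^bsub>GL_group\<^esub> y \<in> carrier GL_group"
    by (auto simp: GL_group_def)
qed (auto simp: GL_group_def blinfun_compose_assoc intro!: exI[of _ id_blinfun])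

lemma GL_group_simps:
  "mult GL_group = (o\<^sub>L)" "one GL_group = id_blinfun"
  by (auto simp: GL_group_def)

lemma Spin91_simps:
  "mult (Spin91 cm cp) = (o\<^sub>L)" "one (Spin91 cm cp) = id_blinfun"
  by (auto simp: Spin91_def GL_group_def)

lemma inv_GL_group:
  assumes "f o\<^sub>L g = id_blinfun" "g o\<^sub>L f = id_blinfun"
  shows "inv\<^bsub>GL_group\<^esub> f = g"
proof -
  interpret group "GL_group :: ('a \<Rightarrow>\<^sub>L 'a) monoid" by (rule group_GL_group)
  show ?thesis using assms by (intro inv_equality) (auto simp: GL_group_def)
qed

context half_spin
begin

abbreviation "Spin \<equiv> carrier (Spin91 cm cp)"

lemma translation_apply [simp]: "blinfun_apply (translation cm u) (m, p) = (m, p + cm u m)"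
proof -
  have "linear (\<lambda>(m, p). (m, p + cm u m))"
    by (auto intro!: linearI simp: cliff_simps algebra_simps)
  then show ?thesis
    by (simp add: translation_def bounded_linear_Blinfun_apply linear_conv_bounded_linear)
qed

lemma inv_translation_apply [simp]: "blinfun_apply (inv_translation cp u) (m, p) = (m + cp u p, p)"
proof -
  have "linear (\<lambda>(m, p). (m + cp u p, p))"
    by (auto intro!: linearI simp: cliff_simps algebra_simps)
  then show ?thesis
    by (simp add: inv_translation_def bounded_linear_Blinfun_apply linear_conv_bounded_linear)
qed

lemma translation_inverse:
  "translation cm u o\<^sub>L translation cm (- u) = id_blinfun"
  "inv_translation cp u o\<^sub>L inv_translation cp (- u) = id_blinfun"
  by (auto intro!: blinfun_eqI simp: cliff_simps)

lemma inv_generators: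
  "inv\<^bsub>GL_group\<^esub> (translation cm u) = translation cm (- u)"
  "inv\<^bsub>GL_group\<^esub> (inv_translation cp u) = inv_translation cp (- u)"
  using translation_inverse[of u] translation_inverse[of "- u"]
  by (auto intro!: inv_GL_group)

lemma generators_GL: "range (translation cm) \<union> range (inv_translation cp) \<subseteq> carrier GL_group"
  using translation_inverse[of "- _"] translation_inverse by (fastforce simp: GL_group_def)

lemma group_Spin91: "group (Spin91 cm cp)"
  unfolding Spin91_def
  by (intro group.subgroup_imp_group[OF group_GL_group] group.generate_is_subgroup[OF group_GL_group]
      generators_GL)

lemma Spin_compose: "g \<in> Spin \<Longrightarrow> h \<in> Spin \<Longrightarrow> g o\<^sub>L h \<in> Spin"
  using generate.eng[of g GL_group _ h] by (simp add: Spin91_def GL_group_simps)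

lemma Spin_id: "id_blinfun \<in> Spin"
  using generate.one[of GL_group] by (simp add: Spin91_def GL_group_simps)

lemma translation_in_Spin: "translation cm u \<in> Spin"
  and inv_translation_in_Spin: "inv_translation cp u \<in> Spin"
  by (auto simp: Spin91_def intro!: generate.incl)

lemma Spin_inverse:
  assumes "g \<in> Spin"
  obtains h where "h \<in> Spin" "g o\<^sub>L h = id_blinfun" "h o\<^sub>L g = id_blinfun"
  using group.l_inv[OF group_Spin91 assms] group.r_inv[OF group_Spin91 assms]
    group.inv_closed[OF group_Spin91 assms] that
  by (simp add: Spin91_simps)

lemma Spin_inverse_unique:
  assumes "g \<in> Spin" "h o\<^sub>L g = id_blinfun"
  shows "h \<in> Spin"
  using Spin_inverse[OF assms(1)] assms(2)
  by (metis blinfun_compose_assoc blinfun_compose_id)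

text \<open>The generating set is closed under inverses, so inverses need no separate case.\<close>

lemma Spin_induct [consumes 1, case_names id translation inv_translation compose]:
  assumes "g \<in> Spin" "P id_blinfun" "\<And>u. P (translation cm u)" "\<And>u. P (inv_translation cp u)"
    "\<And>g h. P g \<Longrightarrow> P h \<Longrightarrow> P (g o\<^sub>L h)"
  shows "P g"
proof -
  have "g \<in> generate GL_group (range (translation cm) \<union> range (inv_translation cp))"
    using assms(1) by (simp add: Spin91_def)
  then show ?thesis
    by induction (auto simp: GL_group_simps inv_generators assms(2-5))
qed

text \<open>The double cover of the Lorentz group, in the only form needed: every element of the spin group is
covered by a linear isometry of \<open>R\<^sup>9\<^sup>,\<^sup>1\<close> that intertwines the quadratic maps. For a translation by \<open>u\<close>
it is the substitution \<open>x \<mapsto> x + u\<close> in \<open>k |x|\<^sup>2 + \<langle>x, b\<rangle> + c\<close>.\<close>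

lemma Spin_lorentz:
  assumes "g \<in> Spin"
  shows "\<exists>\<Lambda>. linear \<Lambda> \<and> (\<forall>s t. lform (\<Lambda> s) (\<Lambda> t) = lform s t) \<and>
    (\<forall>\<psi> \<psi>'. tpair (g \<psi>) (g \<psi>') = \<Lambda> (tpair \<psi> \<psi>'))"
  using assms
proof (induction rule: Spin_induct)
  case id
  show ?case by (intro exI[of _ "\<lambda>x. x"]) (simp add: linear_iff)
next
  case (translation u)
  define \<Lambda> where "\<Lambda> = (\<lambda>(k, b, c). (k :: real, b + (2 * k) *\<^sub>R u, c + u \<bullet> b + (u \<bullet> u) * k))"
  have vec: "vp m (q + cm u n) + vp n (p + cm u m) = vp m q + vp n p + (2 * (m \<bullet> n)) *\<^sub>R u" for m n p q
  proof -
    have "x \<bullet> (vp m (q + cm u n) + vp n (p + cm u m))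
        = x \<bullet> (vp m q + vp n p + (2 * (m \<bullet> n)) *\<^sub>R u)" for x
      using cm_exchange[of x m u n]
      by (simp add: inner_add_right inner_vp inner_commute algebra_simps)
    then show ?thesis using vector_eq_ldot by blast
  qed
  have "linear \<Lambda>"
    unfolding \<Lambda>_def by (auto intro!: linearI simp: inner_add_right algebra_simps)
  moreover have "lform (\<Lambda> s) (\<Lambda> t) = lform s t" for s t
    by (cases s; cases t) (simp add: \<Lambda>_def inner_add_left inner_add_right inner_commute algebra_simps)
  moreover have "tpair (translation cm u \<psi>) (translation cm u \<psi>') = \<Lambda> (tpair \<psi> \<psi>')" for \<psi> \<psi>'
    by (cases \<psi>; cases \<psi>') (simp add: \<Lambda>_def vec, simp add: inner_add_left inner_add_right inner_vp
        inner_cm' inner_commute)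
  ultimately show ?case by blast
next
  case (inv_translation u)
  define \<Lambda> where "\<Lambda> = (\<lambda>(k, b, c). (k - u \<bullet> b + (u \<bullet> u) * c, b - (2 * c) *\<^sub>R u, c :: real))"
  have vec: "vp (m + cp u p) q + vp (n + cp u q) p = vp m q + vp n p - (2 * (p \<bullet> q)) *\<^sub>R u" for m n p q
  proof -
    have "x \<bullet> (vp (m + cp u p) q + vp (n + cp u q) p)
        = x \<bullet> (vp m q + vp n p - (2 * (p \<bullet> q)) *\<^sub>R u)" for x
      using cp_exchange[of x p u q] skew[of x "cp u q" p] skew[of x "cp u p" q]
      by (simp add: inner_add_right inner_diff_right inner_vp cliff_simps inner_add_left
          inner_commute algebra_simps)
    then show ?thesis using vector_eq_ldot by blast
  qed
  have "linear \<Lambda>"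
    unfolding \<Lambda>_def by (auto intro!: linearI simp: inner_add_right algebra_simps)
  moreover have "lform (\<Lambda> s) (\<Lambda> t) = lform s t" for s t
    by (cases s; cases t) (simp add: \<Lambda>_def inner_diff_left inner_diff_right inner_commute algebra_simps)
  moreover have "tpair (inv_translation cp u \<psi>) (inv_translation cp u \<psi>') = \<Lambda> (tpair \<psi> \<psi>')" for \<psi> \<psi>'
    using skew[of u "fst \<psi>" "snd \<psi>'"] skew[of u "fst \<psi>'" "snd \<psi>"]
    by (cases \<psi>; cases \<psi>') (simp add: \<Lambda>_def vec, simp add: inner_add_left inner_add_right inner_vp
        inner_cp' inner_commute)
  ultimately show ?case by blast
next
  case (compose g h)
  then obtain \<Lambda> \<Lambda>' where "linear \<Lambda>" "linear \<Lambda>'" "\<forall>s t. lform (\<Lambda> s) (\<Lambda> t) = lform s t"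
    "\<forall>s t. lform (\<Lambda>' s) (\<Lambda>' t) = lform s t" "\<forall>\<psi> \<psi>'. tpair (g \<psi>) (g \<psi>') = \<Lambda> (tpair \<psi> \<psi>')"
    "\<forall>\<psi> \<psi>'. tpair (h \<psi>) (h \<psi>') = \<Lambda>' (tpair \<psi> \<psi>')"
    by blast
  then show ?case
    by (intro exI[of _ "\<Lambda> \<circ> \<Lambda>'"] conjI linear_compose) (simp_all del: split_paired_All)
qed

lemma Spin_det:
  assumes "g \<in> Spin"
  shows "twistor_det cm (g \<psi>1, g \<psi>2) = twistor_det cm (\<psi>1, \<psi>2)"
proof -
  obtain \<Lambda> where "\<forall>s t. lform (\<Lambda> s) (\<Lambda> t) = lform s t"
    "\<forall>\<psi> \<psi>'. tpair (g \<psi>) (g \<psi>') = \<Lambda> (tpair \<psi> \<psi>')"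
    using Spin_lorentz[OF assms] by blast
  then show ?thesis by (simp only: twistor_det_eq)
qed

end

section \<open>Triality\<close>

definition reflect :: "real^8 \<Rightarrow> real^8 \<Rightarrow> real^8" where "reflect u x = x - (2 * (u \<bullet> x)) *\<^sub>R u"

lemma linear_reflect: "linear (reflect u)"
  unfolding reflect_def by (auto intro!: linearI simp: inner_add_right algebra_simps)

lemma inner_reflect: "norm u = 1 \<Longrightarrow> reflect u x \<bullet> reflect u y = x \<bullet> y"
  by (simp add: reflect_def inner_diff_left inner_diff_right norm_eq_1 inner_commute algebra_simps)

lemma reflect_orthogonal: "u \<bullet> x = 0 \<Longrightarrow> reflect u x = x"
  by (simp add: reflect_def)

lemma reflect_difference:
  assumes "norm v = norm b" "v \<noteq> b"
  shows "reflect ((v - b) /\<^sub>R norm (v - b)) v = b"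
proof -
  have "(v - b) \<bullet> (v - b) = 2 * ((v - b) \<bullet> v)"
    using assms(1) by (simp add: norm_eq inner_diff_left inner_diff_right inner_commute)
  moreover have "(v - b) \<bullet> (v - b) \<noteq> 0" using assms(2) by simp
  ultimately have "2 * ((v - b) \<bullet> v) / (norm (v - b))\<^sup>2 = 1"
    by (simp add: power2_norm_eq_inner)
  then have "(2 * (((v - b) /\<^sub>R norm (v - b)) \<bullet> v)) *\<^sub>R ((v - b) /\<^sub>R norm (v - b)) = v - b"
    by (simp add: power2_eq_square divide_inverse algebra_simps)
  then show ?thesis by (simp add: reflect_def)
qed

text \<open>For \<open>u \<noteq> - v\<close> the vector \<open>a\<close> bisects the angle between \<open>u\<close> and \<open>v\<close>; for \<open>u = - v\<close> any unit vector
orthogonal to \<open>u\<close> works.\<close>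

lemma reflect_negates_exists:
  fixes u v :: "real^8"
  assumes "norm u = 1" "norm v = 1"
  obtains a where "norm a = 1" "reflect a u = - v"
proof (cases "u = - v")
  case True
  obtain x :: "real^8" where x: "x \<noteq> 0" "orthogonal u x"
    using orthogonal_to_vector_exists[of u] by auto
  show ?thesis
  proof (rule that[of "x /\<^sub>R norm x"])
    show "norm (x /\<^sub>R norm x) = 1" using x by simp
    show "reflect (x /\<^sub>R norm x) u = - v"
      using x True by (simp add: reflect_orthogonal orthogonal_def inner_commute)
  qed
next
  case False
  show ?thesis
  proof (rule that[of "(u - - v) /\<^sub>R norm (u - - v)"])
    show "norm ((u - - v) /\<^sub>R norm (u - - v)) = 1" using False by (simp add: eq_neg_iff_add_eq_0)
    show "reflect ((u - - v) /\<^sub>R norm (u - - v)) u = - v"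
      using False assms by (intro reflect_difference) auto
  qed
qed

fun ocnj :: "oct \<Rightarrow> oct" where "ocnj (a, b) = (qcnj a, - b)"

lemma ocnj_eq: "ocnj z = (2 * (z \<bullet> oone)) *\<^sub>R oone - z"
proof -
  obtain a b c d where "z = ((a, b), (c, d))" by (metis surj_pair)
  then show ?thesis by (simp add: oone_def complex_eq_iff inner_complex_def)
qed

lemma ocnj_omult: "ocnj (omult x y) = omult (ocnj y) (ocnj x)"
proof -
  obtain a b c d a' b' c' d' where "x = ((a, b), (c, d))" "y = ((a', b'), (c', d'))"
    by (metis surj_pair)
  then show ?thesis by (simp add: algebra_simps)
qed

lemma ocnj_ocnj [simp]: "ocnj (ocnj z) = z"
  by (cases z; cases "fst z") auto

lemma ocnj_oone [simp]: "ocnj oone = oone"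
  by (simp add: oone_def)

lemma linear_ocnj: "linear ocnj"
  by (rule linearI) (auto simp: ocnj_eq[abs_def] inner_add_left algebra_simps)

lemma oone_Basis: "oone \<in> Basis"
  by (simp add: oone_def Basis_prod_def Basis_complex_def zero_prod_def)

text \<open>Isometric coordinates on \<open>R\<^sup>8\<close>, \<open>S\<^sup>-\<close> and \<open>S\<^sup>+\<close> in which the Clifford product \<open>R\<^sup>8 \<times> S\<^sup>- \<rightarrow> S\<^sup>+\<close> is octonion
multiplication.\<close>

locale octonion_half_spin = half_spin cm cp
  for cm :: "real^8 \<Rightarrow> 'm::euclidean_space \<Rightarrow> 'p::euclidean_space" and cp :: "real^8 \<Rightarrow> 'p \<Rightarrow> 'm" +
  fixes fV :: "oct \<Rightarrow> real^8" and fM :: "oct \<Rightarrow> 'm" and fP :: "oct \<Rightarrow> 'p"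
  assumes lin: "linear fV" "linear fM" "linear fP"
    and isom: "fV a \<bullet> fV b = a \<bullet> b" "fM a \<bullet> fM b = a \<bullet> b" "fP a \<bullet> fP b = a \<bullet> b"
    and cm_coord: "cm (fV a) (fM b) = fP (omult a b)"

text \<open>Identify \<open>R\<^sup>8\<close> with \<open>S\<^sup>+\<close> by \<open>x \<mapsto> x \<cdot> m\<^sub>0\<close> and \<open>S\<^sup>-\<close> with \<open>S\<^sup>+\<close> by \<open>m \<mapsto> x\<^sub>0 \<cdot> m\<close>; the Clifford product
then becomes a product on \<open>S\<^sup>+\<close> with unit \<open>x\<^sub>0 \<cdot> m\<^sub>0\<close> and multiplicative norm. The inverse
identifications are \<open>vp m\<^sub>0\<close> and minus multiplication by \<open>x\<^sub>0\<close>.\<close>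

lemma (in half_spin) octonion_coordinates:
  assumes "norm m0 = 1" "norm x0 = 1"
  obtains fV fM fP where "octonion_half_spin cm cp fV fM fP" "fM oone = m0" "fV oone = x0"
proof -
  have n: "m0 \<bullet> m0 = 1" "x0 \<bullet> x0 = 1" "m0 \<noteq> 0" using assms by (auto simp: norm_eq_1)
  define mul where "mul a b = cm (vp m0 a) (- cp x0 b)" for a b
  have cm_vp: "cm (vp m0 a) m0 = a" for a
    using cm_surj[OF n(3), of a] n vp_cm[of m0] by auto
  have cm_x0: "cm x0 (- cp x0 b) = b" for b
    by (simp add: cliff_simps cm_cp n)
  have alg: "composition_algebra mul (cm x0 m0)"
  proof (intro composition_algebra.intro)
    show "bilinear mul"
      unfolding mul_def bilinear_def
      by (auto intro!: linearI simp: cliff_simps bilinear_radd[OF bilinear_vp]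
          bilinear_rmul[OF bilinear_vp])
    show "norm (mul a b) = norm a * norm b" for a b
    proof -
      have "mul a b \<bullet> mul a b = (a \<bullet> a) * (b \<bullet> b)"
        by (simp add: mul_def inner_cm inner_vp_vp n inner_cp cliff_simps)
      then show ?thesis by (simp add: norm_eq_sqrt_inner real_sqrt_mult)
    qed
    show "mul (cm x0 m0) a = a" for a by (simp add: mul_def vp_cm n cm_x0)
    show "mul a (cm x0 m0) = a" for a by (simp add: mul_def cp_cm n cm_vp)
    show "norm (cm x0 m0) = 1" by (simp add: norm_eq_1 inner_cm n)
  qed
  obtain f where f: "linear f" "\<And>a b. f a \<bullet> f b = a \<bullet> b" "\<And>a b. f (omult a b) = mul (f a) (f b)"
    "f oone = cm x0 m0"
    using composition_algebra.octonion_embedding[OF alg dim_plus] by blast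
  show ?thesis
  proof (rule that)
    show "octonion_half_spin cm cp (\<lambda>a. vp m0 (f a)) (\<lambda>a. - cp x0 (f a)) f"
    proof (intro octonion_half_spin.intro octonion_half_spin_axioms.intro half_spin_axioms f(1))
      show "linear (\<lambda>a. vp m0 (f a))"
        using linear_compose[OF f(1), of "vp m0"] bilinear_vp by (simp add: bilinear_def o_def)
      show "linear (\<lambda>a. - cp x0 (f a))"
        using linear_compose_neg[OF linear_compose[OF f(1) linear_cp(2)[of x0]]] by (simp add: o_def)
    qed (auto simp: f mul_def inner_vp_vp inner_cp' n)
    show "- cp x0 (f oone) = m0" by (simp only: f cp_cm n) simp
    show "vp m0 (f oone) = x0" by (simp only: f vp_cm n) simp
  qed
qed

context half_spin
begin

text \<open>Isometries \<open>\<alpha>\<close> of \<open>S\<^sup>-\<close>, \<open>\<beta>\<close> of \<open>S\<^sup>+\<close> and \<open>\<sigma>\<close> of \<open>R\<^sup>8\<close> compatible with Clifford multiplication: the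
elements of \<open>Spin(8)\<close> together with their images in \<open>SO(8)\<close>.\<close>

definition triality :: "('m \<Rightarrow> 'm) \<Rightarrow> ('p \<Rightarrow> 'p) \<Rightarrow> (real^8 \<Rightarrow> real^8) \<Rightarrow> bool"
  where "triality \<alpha> \<beta> \<sigma> \<longleftrightarrow> linear \<alpha> \<and> linear \<beta> \<and> linear \<sigma> \<and>
    (\<forall>m n. \<alpha> m \<bullet> \<alpha> n = m \<bullet> n) \<and> (\<forall>p q. \<beta> p \<bullet> \<beta> q = p \<bullet> q) \<and> (\<forall>x y. \<sigma> x \<bullet> \<sigma> y = x \<bullet> y) \<and>
    (\<forall>x m. \<beta> (cm x m) = cm (\<sigma> x) (\<alpha> m))"

definition diag :: "('m \<Rightarrow> 'm) \<Rightarrow> ('p \<Rightarrow> 'p) \<Rightarrow> ('m \<times> 'p) \<Rightarrow>\<^sub>L ('m \<times> 'p)"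
  where "diag \<alpha> \<beta> = Blinfun (\<lambda>(m, p). (\<alpha> m, \<beta> p))"

lemma diag_apply: "linear \<alpha> \<Longrightarrow> linear \<beta> \<Longrightarrow> blinfun_apply (diag \<alpha> \<beta>) (m, p) = (\<alpha> m, \<beta> p)"
proof -
  assume "linear \<alpha>" "linear \<beta>"
  then have "linear (\<lambda>(m, p). (\<alpha> m, \<beta> p))"
    by (auto intro!: linearI simp: linear_add linear_scale)
  then show ?thesis
    by (simp add: diag_def bounded_linear_Blinfun_apply linear_conv_bounded_linear)
qed

lemma triality_compose:
  assumes "triality \<alpha> \<beta> \<sigma>" "triality \<alpha>' \<beta>' \<sigma>'"
  shows "triality (\<alpha> \<circ> \<alpha>') (\<beta> \<circ> \<beta>') (\<sigma> \<circ> \<sigma>')"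
  using assms unfolding triality_def by (auto intro!: linear_compose)

lemma diag_compose:
  assumes "triality \<alpha> \<beta> \<sigma>" "triality \<alpha>' \<beta>' \<sigma>'"
  shows "diag \<alpha> \<beta> o\<^sub>L diag \<alpha>' \<beta>' = diag (\<alpha> \<circ> \<alpha>') (\<beta> \<circ> \<beta>')"
  using assms triality_compose[OF assms]
  by (intro blinfun_eqI) (auto simp: triality_def diag_apply)

text \<open>Clifford multiplication by a unit vector \<open>u\<close> on \<open>S\<^sup>- \<oplus> S\<^sup>+\<close>, as the Weyl element of the \<open>SL\<^sub>2\<close> generated by
the two kinds of translation by multiples of \<open>u\<close>.\<close>

definition swap :: "real^8 \<Rightarrow> ('m \<times> 'p) \<Rightarrow>\<^sub>L ('m \<times> 'p)"
  where "swap u = translation cm u o\<^sub>L (inv_translation cp u o\<^sub>L translation cm u)"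

lemma swap_in_Spin: "swap u \<in> Spin"
  unfolding swap_def by (intro Spin_compose translation_in_Spin inv_translation_in_Spin)

lemma swap_apply: "norm u = 1 \<Longrightarrow> blinfun_apply (swap u) (m, p) = (cp u p, cm u m)"
  by (simp add: swap_def cliff_simps cp_cm cm_cp norm_eq_1)

text \<open>Conjugation by a unit vector in the Clifford algebra is minus the reflection in it.\<close>

lemma clifford_reflect:
  "norm v = 1 \<Longrightarrow> cp v (cm x m) = - cp (reflect v x) (cm v m)"
  "norm v = 1 \<Longrightarrow> cm v (cp x p) = - cm (reflect v x) (cp v p)"
proof -
  have "cp v (cm x m) = (- 2 * (v \<bullet> x)) *\<^sub>R m - cp x (cm v m)"
    "cm v (cp x p) = (- 2 * (v \<bullet> x)) *\<^sub>R p - cm x (cp v p)"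
    using clifford_minus[of v x m] clifford_plus[of v x p] by (metis add_diff_cancel_right')+
  then show "norm v = 1 \<Longrightarrow> cp v (cm x m) = - cp (reflect v x) (cm v m)"
    "norm v = 1 \<Longrightarrow> cm v (cp x p) = - cm (reflect v x) (cp v p)"
    by (simp_all add: reflect_def cliff_simps cp_cm cm_cp norm_eq_1)
qed

lemma triality_swap_swap:
  assumes "norm u = 1" "norm v = 1"
  shows "triality (\<lambda>m. cp u (cm v m)) (\<lambda>p. cm u (cp v p)) (reflect u \<circ> reflect v)"
    and "diag (\<lambda>m. cp u (cm v m)) (\<lambda>p. cm u (cp v p)) \<in> Spin"
proof -
  have [simp]: "u \<bullet> u = 1" "v \<bullet> v = 1" using assms by (auto simp: norm_eq_1)
  have lin: "linear (\<lambda>m. cp u (cm v m))" "linear (\<lambda>p. cm u (cp v p))"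
    by (auto intro!: linearI simp: cliff_simps)
  show "triality (\<lambda>m. cp u (cm v m)) (\<lambda>p. cm u (cp v p)) (reflect u \<circ> reflect v)"
    unfolding triality_def using assms lin
    by (auto intro!: linear_compose linear_reflect
        simp: inner_reflect inner_cm' inner_cp' clifford_reflect[of v] clifford_reflect[of u "reflect v _"] cliff_simps)
  have "diag (\<lambda>m. cp u (cm v m)) (\<lambda>p. cm u (cp v p)) = swap u o\<^sub>L swap v"
    using lin assms by (intro blinfun_eqI) (auto simp: diag_apply swap_apply)
  then show "diag (\<lambda>m. cp u (cm v m)) (\<lambda>p. cm u (cp v p)) \<in> Spin"
    by (simp add: Spin_compose swap_in_Spin)
qed

text \<open>The inductive proof that isometries are products of reflections, carried out with pairs of
reflections because only even products preserve \<open>S\<^sup>-\<close> and \<open>S\<^sup>+\<close>. The second reflection is always the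
one in the spare vector \<open>w\<close>, which leaves everything already fixed in place.\<close>

lemma triality_fix_orthonormal:
  assumes "finite F" "norm w = 1" "\<And>b. b \<in> F \<Longrightarrow> norm b = 1 \<and> w \<bullet> b = 0"
    "\<And>a b. a \<in> F \<Longrightarrow> b \<in> F \<Longrightarrow> a \<noteq> b \<Longrightarrow> a \<bullet> b = 0" "triality \<alpha> \<beta> \<sigma>"
  shows "\<exists>g\<in>Spin. \<exists>\<alpha>' \<beta>' \<sigma>'. triality \<alpha>' \<beta>' \<sigma>' \<and> (\<forall>b\<in>F. \<sigma>' b = b) \<and> g o\<^sub>L diag \<alpha> \<beta> = diag \<alpha>' \<beta>'"
  using assms
proof (induction F)
  case empty
  then show ?case using Spin_id by force
next
  case (insert b F)
  then obtain g \<alpha>' \<beta>' \<sigma>' where g: "g \<in> Spin" "triality \<alpha>' \<beta>' \<sigma>'" "\<And>b. b \<in> F \<Longrightarrow> \<sigma>' b = b"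
    "g o\<^sub>L diag \<alpha> \<beta> = diag \<alpha>' \<beta>'"
    by (metis (no_types, lifting) insertCI)
  have nb: "norm b = 1" "w \<bullet> b = 0" using insert.prems by auto
  define v where "v = \<sigma>' b"
  have inner: "\<sigma>' x \<bullet> \<sigma>' y = x \<bullet> y" for x y using g(2) by (simp add: triality_def)
  have v: "norm v = 1" using nb inner[of b b] by (simp add: v_def norm_eq_1)
  have va: "v \<bullet> a = 0" "b \<bullet> a = 0" "w \<bullet> a = 0" if "a \<in> F" for a
  proof -
    show ba: "b \<bullet> a = 0" using insert.prems(3)[of b a] insert.hyps that by auto
    show "v \<bullet> a = 0" using inner[of b a] ba g(3)[OF that] by (simp add: v_def)
    show "w \<bullet> a = 0" using insert.prems that by auto
  qed
  show ?case
  proof (cases "v = b")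
    case True
    then have "\<forall>a\<in>insert b F. \<sigma>' a = a" using g(3) by (auto simp: v_def)
    then show ?thesis using g by blast
  next
    case False
    define u where "u = (v - b) /\<^sub>R norm (v - b)"
    have u: "norm u = 1" using False by (simp add: u_def)
    have ua: "u \<bullet> a = 0" if "a \<in> F" for a
      using va[OF that] by (simp add: u_def inner_diff_left)
    have "reflect u v = b" using reflect_difference[of v b] False nb v by (simp add: u_def)
    then have fixed: "\<forall>a\<in>insert b F. (reflect w \<circ> reflect u \<circ> \<sigma>') a = a"
      using g(3) va ua nb by (auto simp: v_def reflect_orthogonal)
    note pair = triality_swap_swap[OF insert.prems(1) u]
    have "(diag (\<lambda>m. cp w (cm u m)) (\<lambda>p. cm w (cp u p)) o\<^sub>L g) o\<^sub>L diag \<alpha> \<beta>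
        = diag ((\<lambda>m. cp w (cm u m)) \<circ> \<alpha>') ((\<lambda>p. cm w (cp u p)) \<circ> \<beta>')"
      by (simp only: blinfun_compose_assoc g(4) diag_compose[OF pair(1) g(2)])
    then show ?thesis
      using fixed triality_compose[OF pair(1) g(2)] Spin_compose[OF pair(2) g(1)] by blast
  qed
qed

lemma minus_id_in_Spin: "- id_blinfun \<in> Spin"
proof -
  have n: "norm (axis 1 1 :: real^8) = 1" by (simp add: norm_axis_1)
  have "swap (axis 1 1) o\<^sub>L swap (axis 1 1) = - id_blinfun"
    using n by (intro blinfun_eqI)
      (auto simp: swap_apply cp_cm cm_cp norm_eq_1 blinfun.minus_left)
  then show ?thesis by (metis Spin_compose swap_in_Spin)
qed

end

context octonion_half_spin
begin

lemma bijs: "bij fV" "bij fM" "bij fP"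
  using lin isom dim_minus dim_plus by (auto intro!: linear_isometry_bij)

lemma coord_inject: "fV a = fV b \<longleftrightarrow> a = b" "fM a = fM b \<longleftrightarrow> a = b" "fP a = fP b \<longleftrightarrow> a = b"
  using bijs by (auto simp: bij_def inj_eq)

lemma coord_linear_simps:
  "fV (a + b) = fV a + fV b" "fV (r *\<^sub>R a) = r *\<^sub>R fV a" "fV (- a) = - fV a"
  "fM (a + b) = fM a + fM b" "fM (r *\<^sub>R a) = r *\<^sub>R fM a" "fM (- a) = - fM a"
  "fP (a + b) = fP a + fP b" "fP (r *\<^sub>R a) = r *\<^sub>R fP a" "fP (- a) = - fP a"
  using lin by (auto simp: linear_add linear_scale linear_neg)

text \<open>If \<open>\<sigma>\<close> is the identity, then \<open>\<alpha>\<close> and \<open>\<beta>\<close> are both right multiplication by \<open>a = \<alpha> 1\<close>, and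
compatibility says that \<open>a\<close> lies in the right nucleus; hence \<open>a = \<plusminus> 1\<close>.\<close>

lemma triality_over_identity:
  assumes "triality \<alpha> \<beta> (\<lambda>x. x)"
  shows "diag \<alpha> \<beta> = id_blinfun \<or> diag \<alpha> \<beta> = - id_blinfun"
proof -
  note t = assms[unfolded triality_def]
  obtain a where a: "\<alpha> (fM oone) = fM a" using bijs(2) by (metis bij_pointE)
  have \<beta>: "\<beta> (fP z) = fP (omult z a)" for z
  proof -
    have "\<beta> (fP z) = \<beta> (cm (fV z) (fM oone))" by (simp only: cm_coord omult_one)
    also have "\<dots> = cm (fV z) (\<alpha> (fM oone))" using t by blast
    finally show ?thesis by (simp only: a cm_coord)
  qed
  have \<alpha>: "\<alpha> (fM z) = fM (omult z a)" for z
  proof -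
    obtain y where y: "\<alpha> (fM z) = fM y" using bijs(2) by (metis bij_pointE)
    have "fP (omult z a) = \<beta> (cm (fV oone) (fM z))" by (simp only: cm_coord omult_one \<beta>)
    also have "\<dots> = cm (fV oone) (\<alpha> (fM z))" using t by blast
    also have "\<dots> = fP y" by (simp only: y cm_coord omult_one)
    finally show ?thesis by (simp only: y coord_inject)
  qed
  have "omult (omult x m) a = omult x (omult m a)" for x m
  proof -
    have "fP (omult (omult x m) a) = \<beta> (cm (fV x) (fM m))" by (simp only: cm_coord \<beta>)
    also have "\<dots> = cm (fV x) (\<alpha> (fM m))" using t by blast
    finally show ?thesis by (simp only: \<alpha> cm_coord coord_inject)
  qed
  then obtain r where r: "a = r *\<^sub>R oone" using omult_nucleus by blast
  have "a \<bullet> a = 1"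
    using t isom(2)[of oone oone] isom(2)[of a a] a inner_same_Basis[OF oone_Basis] by metis
  then have "r = 1 \<or> r = - 1"
    unfolding r inner_scaleR_left inner_scaleR_right inner_same_Basis[OF oone_Basis]
    by (simp add: square_eq_1_iff)
  moreover have "omult z a = r *\<^sub>R z" for z
  proof -
    obtain b c d e where "z = ((b, c), (d, e))" by (metis surj_pair)
    then show ?thesis by (simp add: r oone_def scaleR_conv_of_real zero_prod_def mult.commute)
  qed
  then have "\<alpha> m = r *\<^sub>R m" "\<beta> p = r *\<^sub>R p" for m p
    using \<alpha> \<beta> bijs by (metis bij_pointE coord_linear_simps)+
  then have "blinfun_apply (diag \<alpha> \<beta>) \<psi> = r *\<^sub>R \<psi>" for \<psi>
    using t by (cases \<psi>) (simp add: diag_apply)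
  ultimately show ?thesis
    by (auto intro!: blinfun_eqI simp: blinfun.minus_left)
qed

text \<open>Minus the octonion conjugation is the reflection in the hyperplane orthogonal to 1. If it were
covered, then \<open>\<alpha> z = conj z * a\<close> and \<open>\<beta> z = - (conj z * a)\<close> with \<open>a = \<alpha> 1\<close>; as conjugation reverses
products, compatibility puts \<open>a\<close> in the twisted nucleus, which is zero.\<close>

lemma no_triality_over_reflection:
  assumes "triality \<alpha> \<beta> \<sigma>" "\<And>z. \<sigma> (fV z) = - fV (ocnj z)"
  shows False
proof -
  note t = assms(1)[unfolded triality_def]
  obtain a where a: "\<alpha> (fM oone) = fM a" using bijs(2) by (metis bij_pointE)
  have t': "\<beta> (cm (fV x) m) = - cm (fV (ocnj x)) (\<alpha> m)" for x m
    using t assms(2) by (simp add: cliff_simps)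
  have \<beta>: "\<beta> (fP z) = - fP (omult (ocnj z) a)" for z
    using t'[of z "fM oone"] unfolding cm_coord omult_one a by simp
  have \<alpha>: "\<alpha> (fM z) = fM (omult (ocnj z) a)" for z
  proof -
    obtain y where y: "\<alpha> (fM z) = fM y" using bijs(2) by (metis bij_pointE)
    have "- fP (omult (ocnj z) a) = - fP y"
      using t'[of oone "fM z"] unfolding ocnj_oone y cm_coord omult_one \<beta> .
    then show ?thesis by (simp only: y coord_inject neg_equal_iff_equal)
  qed
  have "omult (omult m x) a = omult x (omult m a)" for x m
    using t'[of "ocnj x" "fM (ocnj m)"]
    unfolding cm_coord \<beta> \<alpha> ocnj_omult ocnj_ocnj neg_equal_iff_equal coord_inject .
  then have "a = 0" by (rule omult_twisted_nucleus)
  then show False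
    using t isom(2)[of oone oone] isom(2)[of a a] a inner_same_Basis[OF oone_Basis]
    by (metis inner_zero_left zero_neq_one)
qed

text \<open>Modulo the products of two Clifford multiplications, \<open>\<sigma>\<close> can be
assumed to fix the seven imaginary basis vectors; it is then the identity, which is covered only by
\<open>\<plusminus> 1\<close>, or the reflection in the remaining vector, which is not covered at all.\<close>

lemma triality_in_Spin:
  assumes "triality \<alpha> \<beta> \<sigma>"
  shows "diag \<alpha> \<beta> \<in> Spin"
proof -
  let ?F = "fV ` (Basis - {oone})"
  have "\<exists>g\<in>Spin. \<exists>\<alpha>' \<beta>' \<sigma>'. triality \<alpha>' \<beta>' \<sigma>' \<and> (\<forall>b\<in>?F. \<sigma>' b = b) \<and> g o\<^sub>L diag \<alpha> \<beta> = diag \<alpha>' \<beta>'"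
  proof (rule triality_fix_orthonormal[of _ "fV oone"])
    show "norm (fV oone) = 1" by (simp add: norm_eq_1 isom oone_Basis)
    show "norm b = 1 \<and> fV oone \<bullet> b = 0" if "b \<in> ?F" for b
    proof -
      from that obtain a where "b = fV a" "a \<in> Basis" "a \<noteq> oone" by blast
      then show ?thesis by (simp add: norm_eq_1 isom inner_Basis oone_Basis)
    qed
    show "a \<bullet> b = 0" if "a \<in> ?F" "b \<in> ?F" "a \<noteq> b" for a b
    proof -
      from that obtain x y where "a = fV x" "b = fV y" "x \<in> Basis" "y \<in> Basis" "x \<noteq> y" by blast
      then show ?thesis by (simp add: isom inner_Basis)
    qed
  qed (use assms in simp_all)
  then obtain g \<alpha>' \<beta>' \<sigma>' where g: "g \<in> Spin" "triality \<alpha>' \<beta>' \<sigma>'" "g o\<^sub>L diag \<alpha> \<beta> = diag \<alpha>' \<beta>'"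
    and fixed: "\<And>b. b \<in> Basis \<Longrightarrow> b \<noteq> oone \<Longrightarrow> \<sigma>' (fV b) = fV b"
    by blast
  note t = g(2)[unfolded triality_def]
  obtain z where z: "\<sigma>' (fV oone) = fV z" using bijs(1) by (metis bij_pointE)
  have "z \<bullet> b = (z \<bullet> oone) *\<^sub>R oone \<bullet> b" if "b \<in> Basis" for b
  proof (cases "b = oone")
    case False
    have "z \<bullet> b = \<sigma>' (fV oone) \<bullet> \<sigma>' (fV b)" by (simp only: z fixed[OF that False] isom)
    also have "\<dots> = oone \<bullet> b" using t isom(1) by metis
    finally show ?thesis using inner_Basis[OF oone_Basis that] False by (simp)
  qed (simp add: inner_same_Basis[OF oone_Basis])
  then have z': "z = (z \<bullet> oone) *\<^sub>R oone" by (rule euclidean_eqI)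
  have "z \<bullet> z = 1" using t z isom(1) inner_same_Basis[OF oone_Basis] by metis
  moreover have "z \<bullet> z = (z \<bullet> oone) * (z \<bullet> oone)"
    by (subst (1 2) z') (simp add: inner_same_Basis[OF oone_Basis])
  ultimately have "z \<bullet> oone = 1 \<or> z \<bullet> oone = - 1" by (metis square_eq_1_iff)
  then show ?thesis
  proof
    assume "z \<bullet> oone = 1"
    then have "z = oone" using z' by simp
    have "linear (\<sigma>' \<circ> fV)" using t lin(1) linear_compose by blast
    then have "\<sigma>' \<circ> fV = fV"
    proof (rule linear_eq_stdbasis[OF _ lin(1)])
      show "(\<sigma>' \<circ> fV) b = fV b" if "b \<in> Basis" for b
        using fixed[OF that] z \<open>z = oone\<close> by (cases "b = oone") simp_all
    qed
    then have "\<sigma>' = (\<lambda>x. x)" using bijs(1) by (metis bij_pointE comp_apply)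
    then have "diag \<alpha>' \<beta>' \<in> Spin"
      using triality_over_identity g(2) Spin_id minus_id_in_Spin by metis
    then have "\<exists>h\<in>Spin. h o\<^sub>L diag \<alpha>' \<beta>' = diag \<alpha> \<beta>"
      by (metis g(1,3) Spin_inverse blinfun_compose_assoc blinfun_compose_id(2))
    then show ?thesis using Spin_compose \<open>diag \<alpha>' \<beta>' \<in> Spin\<close> by metis
  next
    assume "z \<bullet> oone = - 1"
    then have "z = - oone" using z' by (metis scaleR_minus1_left)
    have lin: "linear (\<sigma>' \<circ> fV)" "linear (\<lambda>z. - fV (ocnj z))"
      using t lin linear_compose linear_compose[OF linear_ocnj, of fV] linear_compose_neg
      by (auto simp: o_def)
    have "\<sigma>' \<circ> fV = (\<lambda>z. - fV (ocnj z))"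
    proof (rule linear_eq_stdbasis[OF lin])
      fix b :: oct assume b: "b \<in> Basis"
      show "(\<sigma>' \<circ> fV) b = - fV (ocnj b)"
      proof (cases "b = oone")
        case True
        then show ?thesis using z \<open>z = - oone\<close> coord_linear_simps(3)[of oone] by simp
      next
        case False
        then have "ocnj b = - b" using inner_Basis[OF b oone_Basis] by (simp add: ocnj_eq)
        then show ?thesis using fixed[OF b False] by (simp add: coord_linear_simps)
      qed
    qed
    then have False using no_triality_over_reflection[OF g(2)] by (metis comp_apply)
    then show ?thesis ..
  qed
qed

end

lemma (in half_spin) triality_in_Spin:
  assumes "triality \<alpha> \<beta> \<sigma>"
  shows "diag \<alpha> \<beta> \<in> Spin"
proof -
  obtain m0 :: 'm where "m0 \<in> Basis" using nonempty_Basis by blast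
  then obtain fV fM fP where "octonion_half_spin cm cp fV fM fP"
    using octonion_coordinates[of m0 "axis 1 1"] by (metis norm_Basis norm_axis_1)
  then show ?thesis using octonion_half_spin.triality_in_Spin assms by blast
qed

section \<open>The group action\<close>

lemma twistor_act_compose:
  "twistor_act (g o\<^sub>L h, A ** B) \<rho> = twistor_act (g, A) (twistor_act (h, B) \<rho>)"
  by (cases \<rho>) (simp add: matrix_matrix_mult_def sum_2 blinfun.add_right blinfun.scaleR_right
      algebra_simps)

lemma twistor_act_id: "twistor_act (id_blinfun, mat 1) \<rho> = \<rho>"
  by (cases \<rho>) (simp add: mat_def flip: zero_prod_def)

lemma GL2_inverse:
  fixes A :: "real^2^2"
  assumes "invertible A"
  obtains B where "invertible B" "A ** B = mat 1" "B ** A = mat 1"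
  using assms unfolding invertible_def by metis

lemma group_GL2: "group GL2"
proof (rule groupI)
  show "\<one>\<^bsub>GL2\<^esub> \<in> carrier GL2" by (simp add: GL2_def invertible_det_nz)
  show "\<exists>B\<in>carrier GL2. B \<otimes>\<^bsub>GL2\<^esub> A = \<one>\<^bsub>GL2\<^esub>" if "A \<in> carrier GL2" for A
    using that by (auto simp: GL2_def elim: GL2_inverse)
qed (auto simp: GL2_def invertible_mult matrix_mul_assoc)

lemma DirProd_simps:
  "carrier (G \<times>\<times> H) = carrier G \<times> carrier H"
  "mult (G \<times>\<times> H) (g, h) (g', h') = (mult G g g', mult H h h')"
  by (auto simp: DirProd_def)

context half_spin
begin

lemma det_act:
  assumes "g \<in> Spin"
  shows "twistor_det cm (twistor_act (g, A) \<rho>) = (det A)\<^sup>2 * twistor_det cm \<rho>"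
  using Spin_det[OF assms] by (cases \<rho>) (simp add: det_linear_combination det_2)

text \<open>The orbit relation of the product group, phrased without group records.\<close>

definition same_orbit :: "('m \<times> 'p) \<times> ('m \<times> 'p) \<Rightarrow> ('m \<times> 'p) \<times> ('m \<times> 'p) \<Rightarrow> bool"
  where "same_orbit \<rho> \<rho>' \<longleftrightarrow> (\<exists>g\<in>Spin. \<exists>A. invertible A \<and> twistor_act (g, A) \<rho> = \<rho>')"

lemma same_orbit_trans [trans]: "same_orbit \<rho> \<rho>' \<Longrightarrow> same_orbit \<rho>' \<rho>'' \<Longrightarrow> same_orbit \<rho> \<rho>''"
  unfolding same_orbit_def by (metis Spin_compose invertible_mult twistor_act_compose)

lemma same_orbit_sym: "same_orbit \<rho> \<rho>' \<Longrightarrow> same_orbit \<rho>' \<rho>"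
  unfolding same_orbit_def by (metis Spin_inverse GL2_inverse twistor_act_compose twistor_act_id)

lemma same_orbit_det: "same_orbit \<rho> \<rho>' \<Longrightarrow> twistor_det cm \<rho> \<noteq> 0 \<Longrightarrow> twistor_det cm \<rho>' \<noteq> 0"
  by (auto simp: same_orbit_def det_act invertible_det_nz simp del: twistor_act.simps)

lemma same_orbit_Spin:
  assumes "g \<in> Spin"
  shows "same_orbit (\<psi>1, \<psi>2) (g \<psi>1, g \<psi>2)"
proof -
  have "twistor_act (g, mat 1) (\<psi>1, \<psi>2) = (g \<psi>1, g \<psi>2)"
    by (simp add: mat_def flip: zero_prod_def)
  moreover have "invertible (mat 1 :: real^2^2)" by (simp add: invertible_det_nz)
  ultimately show ?thesis using assms unfolding same_orbit_def by blast
qed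

lemma same_orbit_scale:
  assumes "a \<noteq> 0" "b \<noteq> 0"
  shows "same_orbit (\<psi>1, \<psi>2) (a *\<^sub>R \<psi>1, b *\<^sub>R \<psi>2)"
proof -
  define A :: "real^2^2" where "A = vector [vector [a, 0], vector [0, b]]"
  have A: "A $ 1 $ 1 = a" "A $ 1 $ 2 = 0" "A $ 2 $ 1 = 0" "A $ 2 $ 2 = b" by (simp_all add: A_def)
  have "invertible A" using assms by (simp add: invertible_det_nz det_2 A)
  then show ?thesis
    unfolding same_orbit_def
    by (intro bexI[of _ id_blinfun] exI[of _ A]) (auto simp: A Spin_id)
qed

text \<open>The action of products \<open>u \<cdot> v \<cdot>\<close> on the unit sphere of \<open>S\<^sup>-\<close>: with \<open>v\<close> fixed, \<open>u\<close> sweeps out the whole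
sphere.\<close>

lemma swap_swap_moves:
  assumes "norm m = 1" "norm m0 = 1"
  obtains g where "g \<in> Spin" "blinfun_apply g (m, 0) = (m0, 0)" "\<And>p. fst (blinfun_apply g (0, p)) = 0"
proof -
  define v :: "real^8" where "v = axis 1 1"
  have v: "norm v = 1" by (simp add: v_def norm_axis_1)
  have n: "m \<bullet> m = 1" "m0 \<bullet> m0 = 1" "v \<bullet> v = 1" using assms v by (auto simp: norm_eq_1)
  have p: "cm v m \<bullet> cm v m = 1" by (simp add: inner_cm n)
  then obtain u where u: "cp u (cm v m) = m0"
    using cp_surj[of "cm v m" m0] by (metis inner_zero_left zero_neq_one)
  have "norm u = 1" using inner_cp[of u "cm v m" u] u p n by (simp add: norm_eq_1)
  then show ?thesis
    using that[of "swap u o\<^sub>L swap v"] v u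
    by (simp add: Spin_compose swap_in_Spin swap_apply cliff_simps)
qed

text \<open>Transitivity of \<open>Spin(7)\<close> on the unit sphere of \<open>S\<^sup>+\<close>, by an explicit product. Choose \<open>a\<close> with
\<open>reflect a u = - v\<close>, a unit vector \<open>c\<close> orthogonal to \<open>u\<close> and \<open>a\<close>, and \<open>d\<close> such that \<open>a u c d\<close> fixes \<open>m\<^sub>0\<close>.
Orthogonality of \<open>c\<close> to both vectors makes \<open>d\<close> orthogonal to \<open>u\<close>, and the anticommutation relations
reduce \<open>a u c d (u \<cdot> m\<^sub>0)\<close> to \<open>- a u a \<cdot> m\<^sub>0 = - reflect a u \<cdot> m\<^sub>0 = v \<cdot> m\<^sub>0\<close>.\<close>

lemma Spin_stabilizer_transitive:
  assumes "norm u = 1" "norm v = 1" "norm m0 = 1"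
  obtains g where "g \<in> Spin" "blinfun_apply g (m0, 0) = (m0, 0)"
    "blinfun_apply g (0, cm u m0) = (0, cm v m0)"
proof -
  obtain a where a: "norm a = 1" "reflect a u = - v"
    using reflect_negates_exists[OF assms(1,2)] by blast
  have "dim {u, a} \<le> 2"
    using dim_le_card'[of "{u, a}"] card_insert_le_m1[of 2 "{a}" u] by simp
  then obtain c0 :: "real^8" where c0: "c0 \<noteq> 0" "\<And>y. y \<in> span {u, a} \<Longrightarrow> orthogonal c0 y"
    using orthogonal_to_subspace_exists[of "{u, a}"] by auto
  define c where "c = c0 /\<^sub>R norm c0"
  have c: "norm c = 1" "c \<bullet> u = 0" "c \<bullet> a = 0"
    using c0 span_base[of _ "{u, a}"] by (auto simp: c_def orthogonal_def)
  have n: "u \<bullet> u = 1" "a \<bullet> a = 1" "c \<bullet> c = 1" "m0 \<bullet> m0 = 1"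
    using assms a c by (auto simp: norm_eq_1)
  have sq: "cp u (cm u m) = - m" "cp a (cm a m) = - m" "cp c (cm c m) = - m"
    "cm u (cp u p) = - p" "cm a (cp a p) = - p" "cm c (cp c p) = - p" for m p
    by (simp_all add: cp_cm cm_cp n)
  have cu: "cp u (cm c m) = - cp c (cm u m)" "cm u (cp c p) = - cm c (cp u p)" for m p
    using clifford_minus[of c u m] clifford_plus[of c u p] c
    by (auto simp: add_eq_0_iff)
  obtain d where d: "cm d m0 = - cm c (cp u (cm a m0))"
    using cm_surj[of m0] n(4) by (metis inner_zero_left zero_neq_one)
  have "d \<bullet> d = 1"
    using inner_cm[of d m0 d] by (simp add: d n inner_cm' inner_cp')
  then have nd: "norm d = 1" by (simp add: norm_eq_1)
  have "d \<bullet> u = 0"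
  proof -
    have "d \<bullet> u = cm d m0 \<bullet> cm u m0" by (simp add: inner_cm n)
    also have "\<dots> = cm u (cp c (cm a m0)) \<bullet> cm u m0" by (simp add: d cu)
    also have "\<dots> = - (cm a m0 \<bullet> cm c m0)" by (simp add: inner_cm' n skew')
    also have "\<dots> = 0" using c(3) by (simp add: inner_cm inner_commute)
    finally show ?thesis .
  qed
  then have du: "cp d (cm u m0) = - cp u (cm d m0)"
    using clifford_minus[of d u m0] by (simp add: add_eq_0_iff)
  have au: "cp u (cm a m0) = (- 2 * (u \<bullet> a)) *\<^sub>R m0 - cp a (cm u m0)"
    using clifford_minus[of u a m0] by (rule add_implies_diff)
  define g where "g = swap a o\<^sub>L (swap u o\<^sub>L (swap c o\<^sub>L swap d))"
  have "g \<in> Spin" unfolding g_def by (intro Spin_compose swap_in_Spin)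
  moreover have "blinfun_apply g (m0, 0) = (m0, 0)"
    using assms a c nd by (simp add: g_def swap_apply cliff_simps d sq)
  moreover have "blinfun_apply g (0, cm u m0) = (0, cm v m0)"
  proof -
    have "cm c (cp d (cm u m0)) = - cm a m0"
      by (simp add: du d cliff_simps cu(1) sq)
    moreover have "cm a (cp u (cm a m0)) = - cm v m0"
    proof -
      have "cm a (cp u (cm a m0)) = cm (reflect a u) m0"
        by (simp add: au reflect_def cliff_simps sq inner_commute)
      then show ?thesis by (simp add: a cliff_simps)
    qed
    ultimately show ?thesis
      using assms a c nd by (simp add: g_def swap_apply cliff_simps)
  qed
  ultimately show ?thesis by (rule that)
qed

text \<open>Move \<open>p(\<psi>\<^sub>1)\<close> to \<open>0\<close> by a translation (after a swap, if it lies at infinity), then \<open>p(\<psi>\<^sub>2)\<close> to \<open>\<infinity>\<close> by an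
inverted translation, normalise by a diagonal matrix, and use the transitivity on unit spinors.
Nonvanishing of the determinant is what keeps the surviving components nonzero.\<close>

lemma orbit_normal_form:
  assumes "twistor_det cm \<rho> \<noteq> 0" "norm m0 = 1" "norm x0 = 1"
  shows "same_orbit \<rho> ((m0, 0), (0, cm x0 m0))"
proof -
  note nonzero = same_orbit_det[OF _ assms(1)]
  have zero: "vp m 0 = 0" "vp 0 p = 0" for m p
    by (simp_all add: bilinear_lzero[OF bilinear_vp] bilinear_rzero[OF bilinear_vp])
  obtain m1 p1 \<psi>2 where \<rho>: "\<rho> = ((m1, p1), \<psi>2)" by (metis surj_pair)
  have "\<exists>m p \<psi>. m \<noteq> 0 \<and> same_orbit \<rho> ((m, p), \<psi>)"
  proof (cases "m1 = 0")
    case True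
    then have "p1 \<noteq> 0"
      using assms(1) by (cases \<psi>2) (auto simp: \<rho> twistor_det_formula zero)
    moreover have "cp x0 p1 \<bullet> cp x0 p1 = p1 \<bullet> p1"
      using assms(3) by (simp add: inner_cp' norm_eq_1)
    ultimately have "cp x0 p1 \<noteq> 0" by auto
    moreover have "same_orbit \<rho> ((cp x0 p1, cm x0 m1), swap x0 \<psi>2)"
      using same_orbit_Spin[OF swap_in_Spin[of x0], of "(m1, p1)" \<psi>2]
      by (simp add: \<rho> swap_apply assms)
    ultimately show ?thesis by blast
  next
    case False
    moreover have "same_orbit \<rho> \<rho>"
      using same_orbit_Spin[OF Spin_id, of "fst \<rho>" "snd \<rho>"] by simp
    ultimately show ?thesis using \<rho> by blast
  qed
  then obtain m p \<psi> where 1: "m \<noteq> 0" "same_orbit \<rho> ((m, p), \<psi>)" by blast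
  obtain c where "cm c m = - p" using cm_surj[OF 1(1)] by blast
  then have "same_orbit ((m, p), \<psi>) ((m, 0), translation cm c \<psi>)"
    using same_orbit_Spin[OF translation_in_Spin[of c], of "(m, p)" \<psi>] by simp
  with 1 have 2: "same_orbit \<rho> ((m, 0), translation cm c \<psi>)" using same_orbit_trans by blast
  obtain m' q where q: "translation cm c \<psi> = (m', q)" by (metis surj_pair)
  have "q \<noteq> 0"
    using nonzero[OF 2] by (auto simp: q twistor_det_formula zero)
  then obtain e where "cp e q = - m'" using cp_surj by blast
  then have "same_orbit ((m, 0), (m', q)) ((m, 0), (0, q))"
    using same_orbit_Spin[OF inv_translation_in_Spin[of e], of "(m, 0)" "(m', q)"]
    by (simp add: cliff_simps)
  with 2 q have "same_orbit \<rho> ((m, 0), (0, q))" using same_orbit_trans by metis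
  also have "same_orbit \<dots> (inverse (norm m) *\<^sub>R (m, 0), inverse (norm q) *\<^sub>R (0, q))"
    using 1 \<open>q \<noteq> 0\<close> by (intro same_orbit_scale) auto
  finally have 3: "same_orbit \<rho> ((m /\<^sub>R norm m, 0), (0, q /\<^sub>R norm q))" by simp
  obtain g where g: "g \<in> Spin" "blinfun_apply g (m /\<^sub>R norm m, 0) = (m0, 0)"
    "\<And>p. fst (blinfun_apply g (0, p)) = 0"
    using swap_swap_moves[of "m /\<^sub>R norm m" m0] 1 assms by auto
  obtain r where r: "blinfun_apply g (0, q /\<^sub>R norm q) = (0, r)"
    using g(3) by (metis prod.collapse)
  note 3
  also have "same_orbit ((m /\<^sub>R norm m, 0), (0, q /\<^sub>R norm q)) ((m0, 0), (0, r))"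
    using same_orbit_Spin[OF g(1)] g(2) r by metis
  finally have 4: "same_orbit \<rho> ((m0, 0), (0, r))" .
  have m0: "m0 \<bullet> m0 = 1" "m0 \<noteq> 0" using assms by (auto simp: norm_eq_1)
  \<comment> \<open>The norm is read off from the invariant determinant, which is \<open>|m\<^sub>0|\<^sup>2 |r|\<^sup>2\<close> on this pair.\<close>
  have "r \<bullet> r = 1"
    using Spin_det[OF g(1), of "(m /\<^sub>R norm m, 0)" "(0, q /\<^sub>R norm q)"] 1 \<open>q \<noteq> 0\<close> m0
    by (simp add: g(2) r twistor_det_formula zero flip: power2_norm_eq_inner)
  obtain y where y: "cm y m0 = r" using cm_surj[OF m0(2)] by blast
  have "norm y = 1" using inner_cm[of y m0 y] m0 \<open>r \<bullet> r = 1\<close> by (simp add: y norm_eq_1)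
  then obtain h where h: "h \<in> Spin" "blinfun_apply h (m0, 0) = (m0, 0)"
    "blinfun_apply h (0, r) = (0, cm x0 m0)"
    using Spin_stabilizer_transitive[of y x0 m0] assms y by metis
  note 4
  also have "same_orbit ((m0, 0), (0, r)) ((m0, 0), (0, cm x0 m0))"
    using same_orbit_Spin[OF h(1)] h(2,3) by metis
  finally show ?thesis .
qed

lemma transitive_on_det_nonzero:
  "transitive_action (Spin91 cm cp \<times>\<times> GL2) {\<rho>. twistor_det cm \<rho> \<noteq> 0}
    (\<lambda>gA. restrict (twistor_act gA) {\<rho>. twistor_det cm \<rho> \<noteq> 0})"
proof -
  define E where "E = {\<rho>. twistor_det cm \<rho> \<noteq> 0}"
  let ?G = "Spin91 cm cp \<times>\<times> GL2" and ?\<phi> = "\<lambda>gA. restrict (twistor_act gA) E"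
  have stays: "twistor_act (g, A) \<rho> \<in> E" if "g \<in> Spin" "invertible A" "\<rho> \<in> E" for g A \<rho>
    using that det_act[OF that(1)] by (simp add: E_def invertible_det_nz)
  have bij: "?\<phi> (g, A) \<in> Bij E" if g: "g \<in> Spin" "invertible A" for g A
  proof -
    obtain h where h: "h \<in> Spin" "g o\<^sub>L h = id_blinfun" "h o\<^sub>L g = id_blinfun"
      using Spin_inverse[OF g(1)] by blast
    obtain B where B: "invertible B" "A ** B = mat 1" "B ** A = mat 1"
      using GL2_inverse[OF g(2)] by blast
    have "twistor_act (g, A) (twistor_act (h, B) \<rho>) = \<rho>"
      "twistor_act (h, B) (twistor_act (g, A) \<rho>) = \<rho>" for \<rho>
      by (simp_all only: twistor_act_compose[symmetric] h B twistor_act_id)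
    then have "bij_betw (?\<phi> (g, A)) E E"
      by (intro bij_betw_byWitness[of _ "twistor_act (h, B)"])
        (use stays g h B in \<open>auto simp del: twistor_act.simps split: if_splits\<close>)
    then show ?thesis by (simp add: Bij_def)
  qed
  have "?\<phi> \<in> hom ?G (BijGroup E)"
  proof (rule homI)
    fix x assume "x \<in> carrier ?G"
    then show "?\<phi> x \<in> carrier (BijGroup E)"
      using bij by (auto simp: DirProd_simps GL2_def BijGroup_def)
  next
    fix x y assume xy: "x \<in> carrier ?G" "y \<in> carrier ?G"
    obtain g A h B where eq: "x = (g, A)" "y = (h, B)" by (metis surj_pair)
    with xy have G: "g \<in> Spin" "h \<in> Spin" "invertible A" "invertible B"
      by (auto simp: DirProd_simps GL2_def)
    have "?\<phi> (g o\<^sub>L h, A ** B) = compose E (?\<phi> (g, A)) (?\<phi> (h, B))"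
      using stays[OF G(2,4)] by (auto simp: compose_def twistor_act_compose simp del: twistor_act.simps)
    then show "?\<phi> (x \<otimes>\<^bsub>?G\<^esub> y) = ?\<phi> x \<otimes>\<^bsub>BijGroup E\<^esub> ?\<phi> y"
      using bij G by (simp add: eq DirProd_simps Spin91_simps GL2_def BijGroup_def)
  qed
  then have "group_hom ?G (BijGroup E) ?\<phi>"
    by (intro group_hom.intro group_hom_axioms.intro DirProd_group group_Spin91 group_GL2 group_BijGroup)
  moreover have "\<exists>gA\<in>carrier ?G. ?\<phi> gA \<rho> = \<rho>'" if "\<rho> \<in> E" "\<rho>' \<in> E" for \<rho> \<rho>'
  proof -
    obtain m0 :: 'm where m0: "norm m0 = 1" using norm_Basis nonempty_Basis by blast
    have normal: "same_orbit \<rho> ((m0, 0), (0, cm (axis 1 1) m0))" if "\<rho> \<in> E" for \<rho>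
      using that m0 by (intro orbit_normal_form) (auto simp: E_def norm_axis_1)
    have "same_orbit \<rho> \<rho>'"
      using same_orbit_trans[OF normal same_orbit_sym[OF normal]] that by blast
    then obtain g A where "g \<in> Spin" "invertible A" "twistor_act (g, A) \<rho> = \<rho>'"
      unfolding same_orbit_def by blast
    with that show ?thesis
      by (intro bexI[of _ "(g, A)"]) (auto simp: DirProd_simps GL2_def simp del: twistor_act.simps)
  qed
  ultimately show ?thesis
    unfolding E_def by (intro transitive_action.intro group_action.intro transitive_action_axioms.intro) auto
qed

end

section \<open>Stabilizers\<close>

lemma top_group_isoI:
  assumes "continuous_on (carrier G) \<Phi>" "continuous_on (carrier H) \<Psi>"
    and "\<And>x. x \<in> carrier G \<Longrightarrow> \<Phi> x \<in> carrier H" "\<And>y. y \<in> carrier H \<Longrightarrow> \<Psi> y \<in> carrier G"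
    and "\<And>x. x \<in> carrier G \<Longrightarrow> \<Psi> (\<Phi> x) = x" "\<And>y. y \<in> carrier H \<Longrightarrow> \<Phi> (\<Psi> y) = y"
    and "\<And>x y. x \<in> carrier G \<Longrightarrow> y \<in> carrier G \<Longrightarrow> \<Phi> (x \<otimes>\<^bsub>G\<^esub> y) = \<Phi> x \<otimes>\<^bsub>H\<^esub> \<Phi> y"
  shows "top_group_iso G H \<Phi>"
proof -
  have "bij_betw \<Phi> (carrier G) (carrier H)"
    using assms by (intro bij_betw_byWitness[of _ \<Psi>]) auto
  moreover have "homeomorphism (carrier G) (carrier H) \<Phi> \<Psi>"
    using assms by (intro homeomorphismI) auto
  ultimately show ?thesis
    using assms by (auto simp: top_group_iso_def iso_def hom_def)
qed

lemma top_group_iso_trans: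
  assumes "top_group_iso G H \<Phi>" "top_group_iso H K \<Psi>"
  shows "top_group_iso G K (\<Psi> \<circ> \<Phi>)"
proof -
  from assms obtain \<Phi>' \<Psi>' where "homeomorphism (carrier G) (carrier H) \<Phi> \<Phi>'"
    "homeomorphism (carrier H) (carrier K) \<Psi> \<Psi>'"
    by (auto simp: top_group_iso_def)
  from homeomorphism_compose[OF this] show ?thesis
    using assms iso_set_trans[of \<Phi> G H \<Psi> K] by (auto simp: top_group_iso_def o_def compose_def)
qed

lemma stabilizer_group_simps:
  "carrier (stabilizer_group G \<rho>) = {gA \<in> carrier G. twistor_act gA \<rho> = \<rho>}"
  "mult (stabilizer_group G \<rho>) = mult G"
  by (auto simp: stabilizer_group_def stabilizer_def)

lemma Blinfun_linear:
  fixes f :: "'a::euclidean_space \<Rightarrow> 'b::euclidean_space"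
  shows "linear f \<Longrightarrow> blinfun_apply (Blinfun f) = f"
  by (simp add: bounded_linear_Blinfun_apply linear_conv_bounded_linear)

lemma linear_inv_bij:
  assumes "linear f" "bij f"
  shows "linear (inv_into UNIV f)"
proof -
  have f: "f (inv_into UNIV f y) = y" "inv_into UNIV f (f x) = x" for x y
    using assms(2) by (simp_all add: bij_is_surj surj_f_inv_f bij_is_inj)
  show ?thesis
  proof (rule linearI)
    show "inv_into UNIV f (x + y) = inv_into UNIV f x + inv_into UNIV f y" for x y
      using f(2)[of "inv_into UNIV f x + inv_into UNIV f y"] by (simp add: linear_add[OF assms(1)] f(1))
    show "inv_into UNIV f (r *\<^sub>R x) = r *\<^sub>R inv_into UNIV f x" for r x
      using f(2)[of "r *\<^sub>R inv_into UNIV f x"] by (simp add: linear_scale[OF assms(1)] f(1))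
  qed
qed

lemma isometry_in_GL:
  fixes s :: "'a::euclidean_space \<Rightarrow>\<^sub>L 'a"
  assumes "\<And>x y. s x \<bullet> s y = x \<bullet> y"
  shows "s \<in> carrier GL_group"
proof -
  have lin: "linear (blinfun_apply s)" using blinfun.bounded_linear_right bounded_linear.linear by blast
  then have bij: "bij (blinfun_apply s)" using assms by (intro linear_isometry_bij) auto
  then have "blinfun_apply (Blinfun (inv_into UNIV (blinfun_apply s))) = inv_into UNIV (blinfun_apply s)"
    using lin by (intro Blinfun_linear linear_inv_bij)
  then have "s o\<^sub>L Blinfun (inv_into UNIV (blinfun_apply s)) = id_blinfun"
    "Blinfun (inv_into UNIV (blinfun_apply s)) o\<^sub>L s = id_blinfun"
    using bij by (auto intro!: blinfun_eqI simp: bij_is_surj surj_f_inv_f bij_is_inj)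
  then show ?thesis by (auto simp: GL_group_def)
qed

text \<open>An element fixing \<open>(m\<^sub>0, 0)\<close> and \<open>(0, p\<^sub>0)\<close> fixes two null vectors of \<open>R\<^sup>9\<^sup>,\<^sup>1\<close>, hence preserves their
orthogonal complement \<open>R\<^sup>8\<close> and the quadratic functions \<open>|\<phi>\<^sup>-|\<^sup>2\<close> and \<open>|\<phi>\<^sup>+|\<^sup>2\<close>. It is therefore block
diagonal with isometric blocks, and equivariance of \<open>vp\<close> is the triality relation.\<close>

lemma (in half_spin) Spin_fixing_pair:
  assumes g: "g \<in> Spin" "blinfun_apply g (m0, 0) = (m0, 0)" "blinfun_apply g (0, p0) = (0, p0)"
    and nonzero: "m0 \<noteq> 0" "p0 \<noteq> 0"
  obtains \<alpha> \<beta> \<sigma> where "triality \<alpha> \<beta> \<sigma>" "g = diag \<alpha> \<beta>"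
proof -
  note zero = bilinear_lzero[OF bilinear_vp] bilinear_rzero[OF bilinear_vp]
  obtain \<Lambda> where \<Lambda>: "linear \<Lambda>" "\<And>s t. lform (\<Lambda> s) (\<Lambda> t) = lform s t"
    "\<And>\<psi> \<psi>'. tpair (g \<psi>) (g \<psi>') = \<Lambda> (tpair \<psi> \<psi>')"
    using Spin_lorentz[OF g(1)] by blast
  \<comment> \<open>The null vectors are the images of \<open>(m\<^sub>0, 0)\<close> and \<open>(0, p\<^sub>0)\<close> under the quadratic map.\<close>
  have ends: "\<Lambda> (m0 \<bullet> m0, 0, 0) = (m0 \<bullet> m0, 0, 0)" "\<Lambda> (0, 0, p0 \<bullet> p0) = (0, 0, p0 \<bullet> p0)"
    using \<Lambda>(3)[of "(m0, 0)" "(m0, 0)"] \<Lambda>(3)[of "(0, p0)" "(0, p0)"] by (simp_all add: g zero)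
  have \<Lambda>_ends: "\<Lambda> (k, 0, 0) = (k, 0, 0)" "\<Lambda> (0, 0, k) = (0, 0, k)" for k
    using ends linear_scale[OF \<Lambda>(1), of "k / (m0 \<bullet> m0)" "(m0 \<bullet> m0, 0, 0)"]
      linear_scale[OF \<Lambda>(1), of "k / (p0 \<bullet> p0)" "(0, 0, p0 \<bullet> p0)"] nonzero by simp_all
  define \<sigma> where "\<sigma> b = fst (snd (\<Lambda> (0, b, 0)))" for b
  have \<Lambda>_mid: "\<Lambda> (0, b, 0) = (0, \<sigma> b, 0)" for b
  proof -
    obtain k b' c where eq: "\<Lambda> (0, b, 0) = (k, b', c)" by (metis surj_pair)
    show ?thesis
      using \<Lambda>(2)[of "(0, b, 0)" "(1, 0, 0)"] \<Lambda>(2)[of "(0, b, 0)" "(0, 0, 1)"]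
      by (simp add: eq \<Lambda>_ends \<sigma>_def)
  qed
  have lin_\<sigma>: "linear \<sigma>"
  proof (rule linearI)
    show "\<sigma> (b + b') = \<sigma> b + \<sigma> b'" for b b'
      using linear_add[OF \<Lambda>(1), of "(0, b, 0)" "(0, b', 0)"] by (simp add: \<Lambda>_mid)
    show "\<sigma> (r *\<^sub>R b) = r *\<^sub>R \<sigma> b" for r b
      using linear_scale[OF \<Lambda>(1), of r "(0, b, 0)"] by (simp add: \<Lambda>_mid)
  qed
  have iso_\<sigma>: "\<sigma> b \<bullet> \<sigma> b' = b \<bullet> b'" for b b'
    using \<Lambda>(2)[of "(0, b, 0)" "(0, b', 0)"] by (simp add: \<Lambda>_mid)
  define \<alpha> where "\<alpha> m = fst (blinfun_apply g (m, 0))" for m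
  define \<beta> where "\<beta> p = snd (blinfun_apply g (0, p))" for p
  have g\<alpha>: "blinfun_apply g (m, 0) = (\<alpha> m, 0)" for m
  proof -
    obtain m' p' where eq: "blinfun_apply g (m, 0) = (m', p')" by (metis surj_pair)
    then show ?thesis
      using \<Lambda>(3)[of "(m, 0)" "(m, 0)"] by (simp add: zero \<Lambda>_ends \<alpha>_def)
  qed
  have g\<beta>: "blinfun_apply g (0, p) = (0, \<beta> p)" for p
  proof -
    obtain m' p' where eq: "blinfun_apply g (0, p) = (m', p')" by (metis surj_pair)
    then show ?thesis
      using \<Lambda>(3)[of "(0, p)" "(0, p)"] by (simp add: zero \<Lambda>_ends \<beta>_def)
  qed
  have lin_\<alpha>: "linear \<alpha>"
  proof (rule linearI)
    show "\<alpha> (m + m') = \<alpha> m + \<alpha> m'" for m m'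
      using blinfun.add_right[of g "(m, 0)" "(m', 0)"] by (simp add: g\<alpha>)
    show "\<alpha> (r *\<^sub>R m) = r *\<^sub>R \<alpha> m" for r m
      using blinfun.scaleR_right[of g r "(m, 0)"] by (simp add: g\<alpha>)
  qed
  have lin_\<beta>: "linear \<beta>"
  proof (rule linearI)
    show "\<beta> (p + p') = \<beta> p + \<beta> p'" for p p'
      using blinfun.add_right[of g "(0, p)" "(0, p')"] by (simp add: g\<beta>)
    show "\<beta> (r *\<^sub>R p) = r *\<^sub>R \<beta> p" for r p
      using blinfun.scaleR_right[of g r "(0, p)"] by (simp add: g\<beta>)
  qed
  have iso_\<alpha>: "\<alpha> m \<bullet> \<alpha> n = m \<bullet> n" for m n
    using \<Lambda>(3)[of "(m, 0)" "(n, 0)"] by (simp add: zero g\<alpha> \<Lambda>_ends)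
  have iso_\<beta>: "\<beta> p \<bullet> \<beta> q = p \<bullet> q" for p q
    using \<Lambda>(3)[of "(0, p)" "(0, q)"] by (simp add: zero g\<beta> \<Lambda>_ends)
  have vp: "vp (\<alpha> m) (\<beta> p) = \<sigma> (vp m p)" for m p
    using \<Lambda>(3)[of "(m, 0)" "(0, p)"] by (simp add: zero g\<alpha> g\<beta> \<Lambda>_mid)
  have "\<beta> (cm x m) = cm (\<sigma> x) (\<alpha> m)" for x m
  proof -
    have "bij \<beta>" using lin_\<beta> iso_\<beta> by (intro linear_isometry_bij) auto
    moreover have "cm (\<sigma> x) (\<alpha> m) \<bullet> \<beta> p = \<beta> (cm x m) \<bullet> \<beta> p" for p
      by (simp add: iso_\<beta> vp iso_\<sigma> flip: inner_vp)
    ultimately have "cm (\<sigma> x) (\<alpha> m) \<bullet> q = \<beta> (cm x m) \<bullet> q" for q by (metis bij_pointE)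
    then show ?thesis by (metis vector_eq_rdot)
  qed
  then have "triality \<alpha> \<beta> \<sigma>"
    by (simp add: triality_def lin_\<alpha> lin_\<beta> lin_\<sigma> iso_\<alpha> iso_\<beta> iso_\<sigma>)
  moreover have "g = diag \<alpha> \<beta>"
  proof (rule blinfun_eqI)
    fix \<psi> :: "'m \<times> 'p"
    obtain m p where \<psi>: "\<psi> = (m, p)" by (metis surj_pair)
    show "blinfun_apply g \<psi> = blinfun_apply (diag \<alpha> \<beta>) \<psi>"
      using blinfun.add_right[of g "(m, 0)" "(0, p)"]
      by (simp add: \<psi> g\<alpha> g\<beta> diag_apply lin_\<alpha> lin_\<beta>)
  qed
  ultimately show ?thesis by (rule that)
qed

text \<open>The set \<open>D\<close> of admissible matrices is a parameter so that the same map serves \<open>GL(2,R)\<close> and its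
identity component.\<close>

lemma (in half_spin) conjugate_stabilizer:
  assumes "g0 \<in> Spin" "h0 \<in> Spin"
    and inv: "g0 o\<^sub>L h0 = id_blinfun" "h0 o\<^sub>L g0 = id_blinfun" "A0 ** B0 = mat 1" "B0 ** A0 = mat 1"
    and \<rho>: "twistor_act (g0, A0) \<rho>0 = \<rho>"
    and D: "\<And>A. A \<in> D \<Longrightarrow> B0 ** A ** A0 \<in> D" "\<And>A. A \<in> D \<Longrightarrow> A0 ** A ** B0 \<in> D"
  shows "top_group_iso (stabilizer_group (Spin91 cm cp \<times>\<times> GL2\<lparr>carrier := D\<rparr>) \<rho>)
    (stabilizer_group (Spin91 cm cp \<times>\<times> GL2\<lparr>carrier := D\<rparr>) \<rho>0)
    (\<lambda>(g, A). (h0 o\<^sub>L g o\<^sub>L g0, B0 ** A ** A0))"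
proof (rule top_group_isoI[where \<Psi> = "\<lambda>(g, A). (g0 o\<^sub>L g o\<^sub>L h0, A0 ** A ** B0)"])
  let ?S = "\<lambda>\<rho>. stabilizer_group (Spin91 cm cp \<times>\<times> GL2\<lparr>carrier := D\<rparr>) \<rho>"
  let ?F = "\<lambda>(g, A). (h0 o\<^sub>L g o\<^sub>L g0, B0 ** A ** A0)"
  let ?G = "\<lambda>(g, A). (g0 o\<^sub>L g o\<^sub>L h0, A0 ** A ** B0)"
  have inverse_act: "twistor_act (h0, B0) \<rho> = \<rho>0"
    unfolding \<rho>[symmetric] twistor_act_compose[symmetric] by (simp only: inv twistor_act_id)
  have mult: "continuous_on S (\<lambda>x. X ** snd x ** Y)"
    for X Y :: "real^2^2" and S :: "((('m \<times> 'p) \<Rightarrow>\<^sub>L ('m \<times> 'p)) \<times> (real^2^2)) set"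
    unfolding matrix_matrix_mult_def by (intro continuous_intros)
  show "continuous_on S ?F" "continuous_on S ?G" for S
    unfolding case_prod_unfold by (intro continuous_intros mult)+
  have act: "twistor_act (h o\<^sub>L g o\<^sub>L k, B ** A ** C) \<rho>' = twistor_act (h, B) (twistor_act (g, A) (twistor_act (k, C) \<rho>'))"
    for h g k :: "('m \<times> 'p) \<Rightarrow>\<^sub>L ('m \<times> 'p)" and A B C \<rho>'
    by (simp only: twistor_act_compose)
  note assoc = blinfun_compose_assoc matrix_mul_assoc[symmetric]
  have cancel: "h0 o\<^sub>L (g0 o\<^sub>L g) = g" "g0 o\<^sub>L (h0 o\<^sub>L g) = g" "B0 ** (A0 ** A) = A" "A0 ** (B0 ** A) = A"
    for g :: "('m \<times> 'p) \<Rightarrow>\<^sub>L ('m \<times> 'p)" and A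
    by (simp_all only: blinfun_compose_assoc[symmetric] matrix_mul_assoc inv blinfun_compose_id matrix_mul_lid)
  show "?F x \<in> carrier (?S \<rho>0)" if "x \<in> carrier (?S \<rho>)" for x
    using that D assms(1,2) by (cases x) (auto simp: stabilizer_group_simps DirProd_simps act \<rho> inverse_act
        intro!: Spin_compose simp del: twistor_act.simps)
  show "?G x \<in> carrier (?S \<rho>)" if "x \<in> carrier (?S \<rho>0)" for x
    using that D assms(1,2) by (cases x) (auto simp: stabilizer_group_simps DirProd_simps act \<rho> inverse_act
        intro!: Spin_compose simp del: twistor_act.simps)
  show "?G (?F x) = x" "?F (?G x) = x" for x
    by (cases x; simp add: assoc cancel inv)+
  fix x y
  show "?F (x \<otimes>\<^bsub>?S \<rho>\<^esub> y) = ?F x \<otimes>\<^bsub>?S \<rho>0\<^esub> ?F y"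
    by (cases x; cases y)
      (simp add: stabilizer_group_simps DirProd_simps Spin91_simps GL2_def assoc cancel)
qed

context octonion_half_spin
begin

abbreviation "x0 \<equiv> fV oone"
abbreviation "m0 \<equiv> fM oone"
abbreviation "p0 \<equiv> fP oone"

lemma units: "x0 \<bullet> x0 = 1" "m0 \<bullet> m0 = 1" "p0 \<bullet> p0 = 1" "cm x0 m0 = p0"
  by (simp_all add: isom oone_Basis cm_coord)

lemma cm_x0: "cm x0 (fM a) = fP a"
  by (simp add: cm_coord)

lemma cp_x0: "cp x0 (fP a) = - fM a"
  using cp_cm[of x0 "fM a"] by (simp add: cm_x0 units)

lemma coord_eqI:
  assumes "\<And>a b. blinfun_apply f (fM a, fP b) = blinfun_apply g (fM a, fP b)"
  shows "f = g"
proof (rule blinfun_eqI)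
  fix \<psi> :: "'m \<times> 'p"
  obtain m p where "\<psi> = (m, p)" by (metis surj_pair)
  moreover obtain a b where "m = fM a" "p = fP b" using bijs by (metis bij_pointE)
  ultimately show "blinfun_apply f \<psi> = blinfun_apply g \<psi>" using assms by simp
qed

text \<open>The matrix units of the factor \<open>R\<^sup>2\<close> in \<open>T = O \<otimes> R\<^sup>2\<close>; \<open>S\<^sup>-\<close> and \<open>S\<^sup>+\<close> are identified by multiplication
by \<open>x\<^sub>0\<close>.\<close>

definition emm :: "('m \<times> 'p) \<Rightarrow>\<^sub>L ('m \<times> 'p)" where "emm = Blinfun (\<lambda>(m, p). (m, 0))"
definition epp :: "('m \<times> 'p) \<Rightarrow>\<^sub>L ('m \<times> 'p)" where "epp = Blinfun (\<lambda>(m, p). (0, p))"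
definition epm :: "('m \<times> 'p) \<Rightarrow>\<^sub>L ('m \<times> 'p)" where "epm = Blinfun (\<lambda>(m, p). (0, cm x0 m))"
definition emp :: "('m \<times> 'p) \<Rightarrow>\<^sub>L ('m \<times> 'p)" where "emp = Blinfun (\<lambda>(m, p). (- cp x0 p, 0))"

lemma e_apply:
  "blinfun_apply emm (m, p) = (m, 0)" "blinfun_apply epp (m, p) = (0, p)"
  "blinfun_apply epm (m, p) = (0, cm x0 m)" "blinfun_apply emp (m, p) = (- cp x0 p, 0)"
proof -
  have "linear (\<lambda>(m :: 'm, p :: 'p). (m, 0 :: 'p))" "linear (\<lambda>(m :: 'm, p :: 'p). (0 :: 'm, p))"
    "linear (\<lambda>(m, p :: 'p). (0 :: 'm, cm x0 m))" "linear (\<lambda>(m :: 'm, p). (- cp x0 p, 0 :: 'p))"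
    by (auto intro!: linearI simp: cliff_simps)
  then show "blinfun_apply emm (m, p) = (m, 0)" "blinfun_apply epp (m, p) = (0, p)"
    "blinfun_apply epm (m, p) = (0, cm x0 m)" "blinfun_apply emp (m, p) = (- cp x0 p, 0)"
    unfolding emm_def epp_def epm_def emp_def by (simp_all only: Blinfun_linear prod.case)
qed

text \<open>The action of a matrix on the factor \<open>R\<^sup>2\<close>, transposed so that \<open>tau A\<close> maps the base vectors
\<open>\<psi>\<^sub>a = 1 \<otimes> e\<^sub>a\<close> to \<open>\<Sum>\<^sub>b A\<^sub>a\<^sub>b \<psi>\<^sub>b\<close>. On the base point it thus agrees with the action of \<open>GL(2,R)\<close>, and it
is an anti-homomorphism.\<close>

definition tau :: "real^2^2 \<Rightarrow> ('m \<times> 'p) \<Rightarrow>\<^sub>L ('m \<times> 'p)"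
  where "tau A = A$1$1 *\<^sub>R emm + A$2$1 *\<^sub>R emp + A$1$2 *\<^sub>R epm + A$2$2 *\<^sub>R epp"

text \<open>For \<open>det A = \<plusminus> 1\<close> the adjugate times \<open>det A\<close> is the inverse; this polynomial form is visibly continuous.\<close>

definition tau_inv :: "real^2^2 \<Rightarrow> ('m \<times> 'p) \<Rightarrow>\<^sub>L ('m \<times> 'p)"
  where "tau_inv A = det A *\<^sub>R (A$2$2 *\<^sub>R emm - A$2$1 *\<^sub>R emp - A$1$2 *\<^sub>R epm + A$1$1 *\<^sub>R epp)"

lemmas tau_simps = blinfun.add_left blinfun.diff_left blinfun.scaleR_left e_apply

lemma tau_coord:
  "blinfun_apply (tau A) (fM a, fP b)
    = (fM (A$1$1 *\<^sub>R a + A$2$1 *\<^sub>R b), fP (A$1$2 *\<^sub>R a + A$2$2 *\<^sub>R b))"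
  by (simp add: tau_def tau_simps cm_x0 cp_x0 coord_linear_simps)

lemma tau_inv_coord:
  "blinfun_apply (tau_inv A) (fM a, fP b)
    = (fM (det A *\<^sub>R (A$2$2 *\<^sub>R a + (- A$2$1) *\<^sub>R b)), fP (det A *\<^sub>R ((- A$1$2) *\<^sub>R a + A$1$1 *\<^sub>R b)))"
  by (simp add: tau_inv_def tau_simps cm_x0 cp_x0 coord_linear_simps linear_diff[OF lin(2)] linear_diff[OF lin(3)]
      scaleR_right_diff_distrib)

lemma tau_mult: "tau (A ** B) = tau B o\<^sub>L tau A"
  by (rule coord_eqI) (simp add: tau_coord matrix_matrix_mult_def sum_2 algebra_simps)

lemma tau_inverse:
  assumes "det A = 1 \<or> det A = - 1"
  shows "tau A o\<^sub>L tau_inv A = id_blinfun" "tau_inv A o\<^sub>L tau A = id_blinfun"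
proof -
  have d: "det A * (A$1$1 * A$2$2) = 1 + det A * (A$1$2 * A$2$1)"
    using assms by (auto simp: det_2)
  have d': "(det A * (A$1$1 * A$2$2)) *\<^sub>R x = x + (det A * (A$1$2 * A$2$1)) *\<^sub>R x" for x :: oct
    unfolding d by (simp add: algebra_simps)
  show "tau A o\<^sub>L tau_inv A = id_blinfun" "tau_inv A o\<^sub>L tau A = id_blinfun"
    by (rule coord_eqI; simp add: tau_coord tau_inv_coord algebra_simps d')+
qed

text \<open>Elementary matrices act as translations and inverted translations along \<open>x\<^sub>0\<close>, and they generate
\<open>SL(2,R)\<close>. The matrix \<open>diag (1, - 1)\<close> acts as \<open>(m, p) \<mapsto> (m, - p)\<close>, which is a triality over \<open>- 1\<close>.\<close>

lemma tau_in_Spin: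
  assumes "det A = 1 \<or> det A = - 1"
  shows "tau A \<in> Spin"
proof -
  define M :: "real \<Rightarrow> real \<Rightarrow> real \<Rightarrow> real \<Rightarrow> real^2^2"
    where "M a b c d = vector [vector [a, b], vector [c, d]]" for a b c d
  have M: "M a b c d $ 1 $ 1 = a" "M a b c d $ 1 $ 2 = b" "M a b c d $ 2 $ 1 = c" "M a b c d $ 2 $ 2 = d"
    for a b c d by (simp_all add: M_def)
  have eqI: "A = B" if "A$1$1 = B$1$1" "A$1$2 = B$1$2" "A$2$1 = B$2$1" "A$2$2 = B$2$2"
    for A B :: "real^2^2"
    using that by (simp add: vec_eq_iff forall_2)
  have prod: "tau (A ** B) \<in> Spin" if "tau A \<in> Spin" "tau B \<in> Spin" for A B
    using that by (simp add: tau_mult Spin_compose)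
  have upper: "tau (M 1 t 0 1) \<in> Spin" for t
  proof -
    have "tau (M 1 t 0 1) = translation cm (t *\<^sub>R x0)"
      by (rule coord_eqI) (simp add: tau_coord M coord_linear_simps cliff_simps cm_x0)
    then show ?thesis by (simp add: translation_in_Spin)
  qed
  have lower: "tau (M 1 0 t 1) \<in> Spin" for t
  proof -
    have "tau (M 1 0 t 1) = inv_translation cp (- t *\<^sub>R x0)"
      by (rule coord_eqI) (simp add: tau_coord M coord_linear_simps cliff_simps cp_x0)
    then show ?thesis by (simp add: inv_translation_in_Spin)
  qed
  \<comment> \<open>With nonzero lower left entry \<open>c\<close> one has upper times lower times upper; the outer parameters are forced by the diagonal.\<close>
  have sl: "tau A \<in> Spin" if "det A = 1" "A$2$1 \<noteq> 0" for A
  proof -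
    define c x y where "c = A$2$1" and "x = (A$1$1 - 1) / c" and "y = (A$2$2 - 1) / c"
    have b: "A$1$2 = (A$1$1 * A$2$2 - 1) / c" using that by (simp add: det_2 c_def field_simps)
    then have "A = M 1 x 0 1 ** M 1 0 c 1 ** M 1 y 0 1"
      using that(2) unfolding c_def[symmetric]
      by (intro eqI) (simp_all add: matrix_matrix_mult_def sum_2 M x_def y_def b field_simps flip: c_def)
    then show ?thesis using prod upper lower by metis
  qed
  have sl': "tau A \<in> Spin" if "det A = 1" for A
  proof (cases "A$2$1 = 0")
    case True
    with that have "A$1$1 \<noteq> 0" by (auto simp: det_2)
    moreover have "det (M 1 0 1 1 ** A) = 1" by (simp add: det_mul that) (simp add: det_2 M)
    ultimately have "tau (M 1 0 1 1 ** A) \<in> Spin"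
      using True by (intro sl) (simp_all add: matrix_matrix_mult_def sum_2 M)
    moreover have "A = M 1 0 (- 1) 1 ** (M 1 0 1 1 ** A)"
      by (intro eqI) (simp_all add: matrix_matrix_mult_def sum_2 M)
    ultimately show ?thesis using prod lower by metis
  qed (use that sl in auto)
  have reflection: "tau (M 1 0 0 (- 1)) \<in> Spin"
  proof -
    have triality: "triality (\<lambda>m. m) (\<lambda>p. - p) (\<lambda>x. - x)"
      by (auto simp: triality_def cliff_simps intro!: linearI)
    then have "tau (M 1 0 0 (- 1)) = diag (\<lambda>m. m) (\<lambda>p. - p)"
      by (intro coord_eqI) (simp add: tau_coord M coord_linear_simps diag_apply triality_def)
    then show ?thesis using triality_in_Spin[OF triality] by simp
  qed
  show ?thesis
  proof (cases "det A = 1")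
    case False
    with assms have "det (A ** M 1 0 0 (- 1)) = 1" by (simp add: det_mul) (simp add: det_2 M)
    then have "tau (A ** M 1 0 0 (- 1)) \<in> Spin" by (rule sl')
    moreover have "A = (A ** M 1 0 0 (- 1)) ** M 1 0 0 (- 1)"
      by (intro eqI) (simp_all add: matrix_matrix_mult_def sum_2 M)
    ultimately show ?thesis using prod reflection by metis
  qed (rule sl')
qed

lemma tau_inv_in_Spin: "det A = 1 \<or> det A = - 1 \<Longrightarrow> tau_inv A \<in> Spin"
  using Spin_inverse_unique tau_in_Spin tau_inverse by blast

text \<open>Coordinates and inclusions as bounded operators, so that passing between an automorphism and its
action on \<open>T\<close> is composition with fixed operators and therefore continuous.\<close>

definition FM where "FM = Blinfun fM"
definition FP where "FP = Blinfun fP"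
definition FM' where "FM' = Blinfun (inv_into UNIV fM)"
definition FP' where "FP' = Blinfun (inv_into UNIV fP)"
definition inM :: "'m \<Rightarrow>\<^sub>L ('m \<times> 'p)" where "inM = Blinfun (\<lambda>m. (m, 0))"
definition inP :: "'p \<Rightarrow>\<^sub>L ('m \<times> 'p)" where "inP = Blinfun (\<lambda>p. (0, p))"

lemma coord_blinfun_apply:
  "blinfun_apply FM = fM" "blinfun_apply FP = fP" "blinfun_apply FM' (fM a) = a"
  "blinfun_apply FP' (fP a) = a" "blinfun_apply inM m = (m, 0)" "blinfun_apply inP p = (0, p)"
proof -
  have "linear (\<lambda>m. (m, 0) :: 'm \<times> 'p)" "linear (\<lambda>p. (0, p) :: 'm \<times> 'p)"
    by (auto intro!: linearI)
  then show "blinfun_apply FM = fM" "blinfun_apply FP = fP" "blinfun_apply FM' (fM a) = a"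
    "blinfun_apply FP' (fP a) = a" "blinfun_apply inM m = (m, 0)" "blinfun_apply inP p = (0, p)"
    using lin bijs
    unfolding FM_def FP_def FM'_def FP'_def inM_def inP_def
    by (simp_all only: Blinfun_linear linear_inv_bij bij_is_inj inv_f_f)
qed

text \<open>An octonion map acting on both copies of \<open>O\<close> in \<open>T\<close>, and the upper left block of an operator on \<open>T\<close>.\<close>

definition emb :: "oct \<Rightarrow>\<^sub>L oct \<Rightarrow> ('m \<times> 'p) \<Rightarrow>\<^sub>L ('m \<times> 'p)"
  where "emb s = (inM o\<^sub>L FM o\<^sub>L s o\<^sub>L FM' o\<^sub>L fst_blinfun) + (inP o\<^sub>L FP o\<^sub>L s o\<^sub>L FP' o\<^sub>L snd_blinfun)"

definition compress :: "('m \<times> 'p) \<Rightarrow>\<^sub>L ('m \<times> 'p) \<Rightarrow> oct \<Rightarrow>\<^sub>L oct"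
  where "compress k = FM' o\<^sub>L fst_blinfun o\<^sub>L k o\<^sub>L inM o\<^sub>L FM"

lemma emb_coord: "blinfun_apply (emb s) (fM a, fP b) = (fM (s a), fP (s b))"
  by (simp add: emb_def blinfun.add_left coord_blinfun_apply)

lemma compress_emb: "compress (emb s) = s"
proof (rule blinfun_eqI)
  fix a
  have "fP 0 = 0" using lin by (simp add: linear_0)
  then show "blinfun_apply (compress (emb s)) a = blinfun_apply s a"
    using emb_coord[of s a 0] by (simp add: compress_def coord_blinfun_apply)
qed

lemma emb_mult: "emb (s o\<^sub>L t) = emb s o\<^sub>L emb t"
  by (rule coord_eqI) (simp add: emb_coord)

lemma emb_tau_commute: "emb s o\<^sub>L tau A = tau A o\<^sub>L emb s"
  by (rule coord_eqI) (simp add: emb_coord tau_coord blinfun.add_right blinfun.scaleR_right)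

lemma emb_in_Spin:
  assumes "s \<in> carrier G2"
  shows "emb s \<in> Spin"
proof -
  have hom: "s (omult a b) = omult (s a) (s b)" for a b
    using assms unfolding G2_def by (simp del: split_paired_All)
  have lin_s: "linear (blinfun_apply s)"
    using blinfun.bounded_linear_right bounded_linear.linear by blast
  define cV where "cV = (\<lambda>x. fV (s (inv_into UNIV fV x)))"
  define cM where "cM = (\<lambda>x. fM (s (inv_into UNIV fM x)))"
  define cP where "cP = (\<lambda>x. fP (s (inv_into UNIV fP x)))"
  have c: "cV (fV a) = fV (s a)" "cM (fM a) = fM (s a)" "cP (fP a) = fP (s a)" for a
    using bijs by (simp_all add: cV_def cM_def cP_def bij_is_inj)
  have "linear cV" "linear cM" "linear cP"
    using linear_compose[OF linear_compose[OF linear_inv_bij[OF lin(1) bijs(1)] lin_s] lin(1)]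
      linear_compose[OF linear_compose[OF linear_inv_bij[OF lin(2) bijs(2)] lin_s] lin(2)]
      linear_compose[OF linear_compose[OF linear_inv_bij[OF lin(3) bijs(3)] lin_s] lin(3)]
    by (simp_all add: cV_def cM_def cP_def o_def)
  moreover have "cV x \<bullet> cV y = x \<bullet> y" for x y
    using bijs(1) G2_norm(2)[OF assms] by (metis bij_pointE c(1) isom(1))
  moreover have "cM x \<bullet> cM y = x \<bullet> y" for x y
    using bijs(2) G2_norm(2)[OF assms] by (metis bij_pointE c(2) isom(2))
  moreover have "cP x \<bullet> cP y = x \<bullet> y" for x y
    using bijs(3) G2_norm(2)[OF assms] by (metis bij_pointE c(3) isom(3))
  moreover have "cP (cm x m) = cm (cV x) (cM m)" for x m
  proof -
    obtain a b where "x = fV a" "m = fM b" using bijs by (metis bij_pointE)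
    then show ?thesis by (simp add: cm_coord c hom)
  qed
  ultimately have triality: "triality cM cP cV" by (simp add: triality_def)
  then have "emb s = diag cM cP"
    by (intro coord_eqI) (simp add: emb_coord diag_apply triality_def c)
  then show ?thesis using triality_in_Spin[OF triality] by simp
qed

text \<open>The triality attached to such an element fixes the units. In octonion coordinates, the relation
\<open>\<beta> (x m) = \<sigma> x * \<alpha> m\<close> gives \<open>\<beta> = \<alpha>\<close> at \<open>x = 1\<close> and \<open>\<beta> = \<sigma>\<close> at \<open>m = 1\<close>, so all three maps are one
automorphism.\<close>

lemma pointwise_stabilizer:
  assumes k: "k \<in> Spin" "blinfun_apply k (m0, 0) = (m0, 0)" "blinfun_apply k (0, p0) = (0, p0)"
  shows "\<exists>s\<in>carrier G2. k = emb s"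
proof -
  have nonzero: "m0 \<noteq> 0" "p0 \<noteq> 0" using units by auto
  obtain \<alpha> \<beta> \<sigma> where triality: "triality \<alpha> \<beta> \<sigma>" and k': "k = diag \<alpha> \<beta>"
    using Spin_fixing_pair[OF k nonzero] by blast
  note t = triality[unfolded triality_def]
  have triality_eq: "\<beta> (cm x m) = cm (\<sigma> x) (\<alpha> m)" for x m
    using t by blast
  have lin_s: "linear (\<lambda>a. inv_into UNIV fM (\<alpha> (fM a)))"
    using linear_compose[OF linear_compose[OF lin(2), of \<alpha>] linear_inv_bij[OF lin(2) bijs(2)]] t
    by (simp add: o_def)
  define s where "s = Blinfun (\<lambda>a. inv_into UNIV fM (\<alpha> (fM a)))"
  have \<alpha>: "\<alpha> (fM a) = fM (s a)" for a
    using bijs by (simp add: s_def Blinfun_linear lin_s bij_is_surj surj_f_inv_f)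
  have fixed: "\<alpha> m0 = m0" "\<beta> p0 = p0" using k t by (simp_all add: k' diag_apply)
  have "cm (\<sigma> x0) m0 = cm x0 m0"
    using triality_eq[of x0 m0] by (simp only: fixed units(4))
  then have "\<sigma> x0 = x0" by (simp add: cm_eq_iff nonzero)
  then have \<beta>: "\<beta> (fP a) = fP (s a)" for a
    using triality_eq[of x0 "fM a"] \<open>\<sigma> x0 = x0\<close> by (simp only: cm_x0 \<alpha>)
  have \<sigma>: "\<sigma> (fV a) = fV (s a)" for a
  proof -
    have "cm (\<sigma> (fV a)) m0 = \<beta> (cm (fV a) m0)" by (simp only: triality_eq fixed)
    also have "\<dots> = cm (fV (s a)) m0" by (simp add: cm_coord \<beta>)
    finally show ?thesis by (simp add: cm_eq_iff nonzero)
  qed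
  have "s (omult a b) = omult (s a) (s b)" for a b
  proof -
    have "fP (s (omult a b)) = \<beta> (cm (fV a) (fM b))" by (simp add: cm_coord \<beta>)
    also have "\<dots> = fP (omult (s a) (s b))" using triality_eq[of "fV a" "fM b"] by (simp only: \<sigma> \<alpha> cm_coord)
    finally show ?thesis by (simp add: coord_inject)
  qed
  moreover have "s a \<bullet> s b = a \<bullet> b" for a b
    using t isom(2) by (metis \<alpha>)
  then have "s \<in> carrier GL_group" by (rule isometry_in_GL)
  ultimately have "s \<in> carrier G2" by (simp add: G2_def del: split_paired_All)
  moreover have "k = emb s"
    using t by (intro coord_eqI) (simp add: k' diag_apply emb_coord \<alpha> \<beta>)
  ultimately show ?thesis by blast
qed

text \<open>On the base point \<open>(g, A)\<close> acts as \<open>g \<circ> tau A\<close> in both components; invariance of the determinant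
forces \<open>det A = \<plusminus> 1\<close>, so that \<open>tau A\<close> lies in the spin group.\<close>

lemma stabilizer_iff:
  assumes "g \<in> Spin"
  shows "twistor_act (g, A) ((m0, 0), (0, p0)) = ((m0, 0), (0, p0)) \<longleftrightarrow>
    (det A = 1 \<or> det A = - 1) \<and> (\<exists>s\<in>carrier G2. g o\<^sub>L tau A = emb s)"
proof -
  have zero: "fM 0 = 0" "fP 0 = 0" using lin by (auto simp: linear_0)
  have "blinfun_apply (tau A) (m0, 0) = A$1$1 *\<^sub>R (m0, 0) + A$1$2 *\<^sub>R (0, p0)"
    "blinfun_apply (tau A) (0, p0) = A$2$1 *\<^sub>R (m0, 0) + A$2$2 *\<^sub>R (0, p0)"
    using tau_coord[of A oone 0] tau_coord[of A 0 oone] by (simp_all add: zero coord_linear_simps)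
  then have act: "twistor_act (g, A) ((m0, 0), (0, p0))
      = (blinfun_apply (g o\<^sub>L tau A) (m0, 0), blinfun_apply (g o\<^sub>L tau A) (0, p0))"
    by (simp only: twistor_act.simps blinfun_apply_blinfun_compose blinfun.add_right blinfun.scaleR_right)
  show ?thesis
  proof
    assume fixed: "twistor_act (g, A) ((m0, 0), (0, p0)) = ((m0, 0), (0, p0))"
    have "twistor_det cm ((m0, 0), (0, p0)) = 1"
      by (simp add: twistor_det_formula units bilinear_rzero[OF bilinear_vp])
    then have "(det A)\<^sup>2 = 1"
      using det_act[OF assms, of A "((m0, 0), (0, p0))"] by (simp only: fixed mult_1_right)
    then have det: "det A = 1 \<or> det A = - 1" by (simp add: power2_eq_1_iff)
    then have "g o\<^sub>L tau A \<in> Spin" using assms by (intro Spin_compose tau_in_Spin)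
    then show "(det A = 1 \<or> det A = - 1) \<and> (\<exists>s\<in>carrier G2. g o\<^sub>L tau A = emb s)"
      using det pointwise_stabilizer fixed unfolding act by simp
  next
    assume "(det A = 1 \<or> det A = - 1) \<and> (\<exists>s\<in>carrier G2. g o\<^sub>L tau A = emb s)"
    then obtain s where "s \<in> carrier G2" "g o\<^sub>L tau A = emb s" by blast
    then show "twistor_act (g, A) ((m0, 0), (0, p0)) = ((m0, 0), (0, p0))"
      using emb_coord[of s oone 0] emb_coord[of s 0 oone] G2_norm(1)[of s]
      unfolding act by (simp add: zero)
  qed
qed

text \<open>On the stabilizer \<open>g \<circ> tau A\<close> is an automorphism acting on both copies of \<open>O\<close>; the block recovers it.\<close>

definition stab_iso :: "(('m \<times> 'p) \<Rightarrow>\<^sub>L ('m \<times> 'p)) \<times> (real^2^2) \<Rightarrow> (oct \<Rightarrow>\<^sub>L oct) \<times> (real^2^2)"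
  where "stab_iso = (\<lambda>(g, A). (compress (g o\<^sub>L tau A), A))"

text \<open>The map is multiplicative although \<open>tau\<close> reverses products, because automorphisms commute with \<open>tau\<close>.\<close>

lemma stabilizer_iso:
  "top_group_iso (stabilizer_group (Spin91 cm cp \<times>\<times> GL2\<lparr>carrier := D\<rparr>) ((m0, 0), (0, p0)))
    (G2 \<times>\<times> GL2\<lparr>carrier := {A \<in> D. det A = 1 \<or> det A = - 1}\<rparr>) stab_iso"
proof (rule top_group_isoI[where \<Psi> = "\<lambda>(s, A). (emb s o\<^sub>L tau_inv A, A)"])
  let ?S = "stabilizer_group (Spin91 cm cp \<times>\<times> GL2\<lparr>carrier := D\<rparr>) ((m0, 0), (0, p0))"
  let ?H = "G2 \<times>\<times> GL2\<lparr>carrier := {A \<in> D. det A = 1 \<or> det A = - 1}\<rparr>"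
  have S: "carrier ?S = {(g, A). g \<in> Spin \<and> A \<in> D \<and> (det A = 1 \<or> det A = - 1) \<and>
      (\<exists>s\<in>carrier G2. g o\<^sub>L tau A = emb s)}"
    by (auto simp: stabilizer_group_simps DirProd_simps stabilizer_iff simp del: twistor_act.simps)
  have H: "carrier ?H = carrier G2 \<times> {A \<in> D. det A = 1 \<or> det A = - 1}"
    by (simp add: DirProd_simps)
  show "continuous_on T stab_iso" for T
    unfolding stab_iso_def compress_def tau_def case_prod_unfold
    by (intro continuous_intros)
  show "continuous_on T (\<lambda>(s, A). (emb s o\<^sub>L tau_inv A, A))" for T
    unfolding emb_def tau_inv_def det_2 case_prod_unfold
    by (intro continuous_intros)
  show "stab_iso x \<in> carrier ?H" if "x \<in> carrier ?S" for x
    using that by (auto simp: S H stab_iso_def compress_emb)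
  have cancel: "(k o\<^sub>L tau_inv A) o\<^sub>L tau A = k" "(k o\<^sub>L tau A) o\<^sub>L tau_inv A = k"
    if "det A = 1 \<or> det A = - 1" for k :: "('m \<times> 'p) \<Rightarrow>\<^sub>L ('m \<times> 'p)" and A
    by (simp_all add: blinfun_compose_assoc tau_inverse[OF that])
  show "(\<lambda>(s, A). (emb s o\<^sub>L tau_inv A, A)) y \<in> carrier ?S" if "y \<in> carrier ?H" for y
    using that by (auto simp: S H cancel intro!: Spin_compose emb_in_Spin tau_inv_in_Spin)
  show "(\<lambda>(s, A). (emb s o\<^sub>L tau_inv A, A)) (stab_iso x) = x" if "x \<in> carrier ?S" for x
  proof -
    from that obtain g A s where x: "x = (g, A)" "det A = 1 \<or> det A = - 1" "g o\<^sub>L tau A = emb s"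
      by (auto simp: S)
    then show ?thesis using cancel(2)[OF x(2), of g] by (simp add: stab_iso_def compress_emb)
  qed
  show "stab_iso ((\<lambda>(s, A). (emb s o\<^sub>L tau_inv A, A)) y) = y" if "y \<in> carrier ?H" for y
    using that by (auto simp: H stab_iso_def cancel compress_emb)
  show "stab_iso (x \<otimes>\<^bsub>?S\<^esub> y) = stab_iso x \<otimes>\<^bsub>?H\<^esub> stab_iso y"
    if xy: "x \<in> carrier ?S" "y \<in> carrier ?S" for x y
  proof -
    from xy obtain g A s h B t where x: "x = (g, A)" "g o\<^sub>L tau A = emb s"
      and y: "y = (h, B)" "h o\<^sub>L tau B = emb t"
      by (auto simp: S)
    have "(g o\<^sub>L h) o\<^sub>L tau (A ** B) = g o\<^sub>L (emb t o\<^sub>L tau A)"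
      by (simp add: tau_mult y(2)[symmetric] blinfun_compose_assoc)
    also have "\<dots> = emb s o\<^sub>L emb t"
      by (simp only: emb_tau_commute x(2)[symmetric] blinfun_compose_assoc)
    finally show ?thesis
      by (simp add: x y stab_iso_def stabilizer_group_simps DirProd_simps Spin91_simps compress_emb
          GL2_def G2_def GL_group_simps flip: emb_mult)
  qed
qed

end

lemma (in half_spin) stabilizer_isomorphic:
  assumes "twistor_det cm \<rho> \<noteq> 0"
  shows "\<exists>\<Phi>. top_group_iso (stabilizer_group (Spin91 cm cp \<times>\<times> GL2) \<rho>) (G2 \<times>\<times> SL2_pm) \<Phi> \<and>
    top_group_iso (stabilizer_group (Spin91 cm cp \<times>\<times> GL2_pos) \<rho>) (G2 \<times>\<times> SL2) \<Phi>"
proof -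
  obtain n0 :: 'm where n0: "norm n0 = 1" using norm_Basis nonempty_Basis by blast
  define y0 :: "real^8" where "y0 = axis 1 1"
  have y0: "norm y0 = 1" by (simp add: y0_def norm_axis_1)
  obtain fV fM fP where o: "octonion_half_spin cm cp fV fM fP" "fM oone = n0" "fV oone = y0"
    using octonion_coordinates[OF n0 y0] by blast
  interpret octonion_half_spin cm cp fV fM fP by (rule o(1))
  let ?\<rho>0 = "((m0, 0), (0, p0))"
  have "same_orbit ?\<rho>0 \<rho>"
    using orbit_normal_form[OF assms n0 y0] same_orbit_sym units(4) o by metis
  then obtain g0 A0 where g0: "g0 \<in> Spin" and A0: "invertible A0" and \<rho>: "twistor_act (g0, A0) ?\<rho>0 = \<rho>"
    unfolding same_orbit_def by blast
  obtain h0 where h0: "h0 \<in> Spin" "g0 o\<^sub>L h0 = id_blinfun" "h0 o\<^sub>L g0 = id_blinfun"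
    using Spin_inverse[OF g0] by blast
  obtain B0 where B0: "invertible B0" "A0 ** B0 = mat 1" "B0 ** A0 = mat 1"
    using GL2_inverse[OF A0] by blast
  have "det (A0 ** B0) = 1" unfolding B0 by simp
  then have det: "det A0 * det B0 = 1" by (simp add: det_mul)
  then have conj: "det (B0 ** A ** A0) = det A" "det (A0 ** A ** B0) = det A" for A
    by (simp_all add: det_mul mult.commute mult.left_commute)
  have iso: "top_group_iso (stabilizer_group (Spin91 cm cp \<times>\<times> GL2\<lparr>carrier := D\<rparr>) \<rho>)
      (G2 \<times>\<times> GL2\<lparr>carrier := {A \<in> D. det A = 1 \<or> det A = - 1}\<rparr>)
      (stab_iso \<circ> (\<lambda>(g, A). (h0 o\<^sub>L g o\<^sub>L g0, B0 ** A ** A0)))"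
    if "\<And>A. A \<in> D \<Longrightarrow> B0 ** A ** A0 \<in> D" "\<And>A. A \<in> D \<Longrightarrow> A0 ** A ** B0 \<in> D" for D
    by (rule top_group_iso_trans[OF conjugate_stabilizer stabilizer_iso])
      (use g0 h0 B0 \<rho> that in auto)
  have "{A :: real^2^2. det A \<noteq> 0 \<and> (det A = 1 \<or> det A = - 1)} = {A. det A = 1 \<or> det A = - 1}"
    "{A :: real^2^2. det A > 0 \<and> (det A = 1 \<or> det A = - 1)} = {A. det A = 1}"
    "GL2\<lparr>carrier := {A. det A \<noteq> 0}\<rparr> = GL2"
    by (auto simp: GL2_def invertible_det_nz)
  then show ?thesis
    using iso[of "{A. det A \<noteq> 0}"] iso[of "{A. det A > 0}"]
    unfolding SL2_pm_def SL2_def GL2_pos_def by (auto simp: conj)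
qed

theorem proposition3:
  fixes cm :: "real^8 \<Rightarrow> 'm::euclidean_space \<Rightarrow> 'p::euclidean_space"
    and cp :: "real^8 \<Rightarrow> 'p \<Rightarrow> 'm"
  assumes "half_spin cm cp"
  shows
    "(\<forall>\<psi>1 \<psi>2. \<psi>1 \<noteq> 0 \<longrightarrow> \<psi>2 \<noteq> 0 \<longrightarrow>
        (twistor_det cm (\<psi>1, \<psi>2) = 0 \<longleftrightarrow> proj cm \<psi>1 = proj cm \<psi>2)) \<and>
     (open {\<rho>. twistor_det cm \<rho> \<noteq> 0} \<and>
      transitive_action (Spin91 cm cp \<times>\<times> GL2) {\<rho>. twistor_det cm \<rho> \<noteq> 0}
        (\<lambda>gA. restrict (twistor_act gA) {\<rho>. twistor_det cm \<rho> \<noteq> 0})) \<and>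
     (\<forall>\<rho>. twistor_det cm \<rho> \<noteq> 0 \<longrightarrow>
        (\<exists>\<Phi>. top_group_iso (stabilizer_group (Spin91 cm cp \<times>\<times> GL2) \<rho>) (G2 \<times>\<times> SL2_pm) \<Phi> \<and>
             top_group_iso (stabilizer_group (Spin91 cm cp \<times>\<times> GL2_pos) \<rho>) (G2 \<times>\<times> SL2) \<Phi>))"
proof -
  interpret half_spin cm cp by (rule assms)
  show ?thesis
    using det_zero_iff_proj_eq open_det_nonzero transitive_on_det_nonzero stabilizer_isomorphic
    by blast
qed

end
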